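(* For any $k\ge2$ there exist online scheduling algorithms for the dynamic bin packing problem, which learn the length of each interval upon its arrival, with the following guarantees on the average cost (total cost divided by $T$). (1) If the extra information beyond the lengths is the average load (a single value), then the average cost is at most $\Pi_k\cdot\mathrm{OPT}_{avg}+k\cdot O\left(\sqrt{\mathrm{OPT}_{avg}\cdot\log\mu}\right)$ in the non-uniform size case, and at most $\mathrm{OPT}_{avg}+O\left(\sqrt{\mathrm{OPT}_{avg}\cdot\log\mu}\right)$ in the uniform size case. (2) If the extra information beyond the lengths is the future load vector, then the average cost is at most $8\cdot\mathrm{OPT}_{avg}$ in the non-uniform size case, and at most $2\cdot\mathrm{OPT}_{avg}$ in the uniform size case. (For comparison, with no extra information beyond the lengths, the previously known bound, due to Azar and Vainstein, is $O(\sqrt{\log\mu})\cdot\mathrm{OPT}_{avg}$ in both cases.)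
   Context: Dynamic bin packing. The time horizon has length $T$, with time steps $t=1,\dots,T$. An instance $\mathcal I$ is a set of intervals (VM requests) $I=[s_I,e_I)$ with size $w_I\le1$; $t\in I$ means $s_I\le t<e_I$, and then $I$ is active at $t$. The length of $I$ is $\ell_I=e_I-s_I$; without loss of generality the minimum length is $1$, and $\mu$ denotes the maximum length (the ratio between the maximum and minimum length). Without loss of generality, at each time at least one interval is active. A schedule assigns each interval to one machine for its entire duration (no migration); at each time the total size of active intervals on a machine is at most $1$. A machine is active at $t$ if at least one interval assigned to it is active at $t$. The total cost of a schedule is the total active time summed over all machines; $\mathrm{OPT}$ is the minimum (offline) cost and $\mathrm{OPT}_{avg}=\mathrm{OPT}/T$. Uniform size case: all sizes equal $1/g$ for some integer $g$. Non-uniform size case: sizes are arbitrary. Online setting: intervals arrive over time, and each must be irrevocably assigned to a machine upon arrival, knowing only the intervals that have arrived so far (sizes and lengths) and the stated extra information. The load vector is $v=(v_1,\dots,v_T)$ with $v_t=\lceil\sum_{I\ni t}w_I\rceil$. The average load is $v_{avg}=\frac1T\sum_{t=1}^Tv_t$. "Given the future load vector" means that at each time $t$ the algorithm knows the total load at all times $t'\in[t,t+\mu)$ (loads of the whole instance, including future arrivals). The quantity $\Pi_k$: static bin packing asks to pack items of sizes in $(0,1]$ into the minimum number of unit bins. The Harmonic algorithm with parameter $k$ splits items into classes with sizes in $(\frac1{j+1},\frac1j]$ for $j=1,\dots,k-1$, and $(0,\frac1k]$, and packs each class separately by Next-Fit (keep one active bin; if an item does not fit, close it and open a new one). $\Pi_k$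 denotes its asymptotic competitive ratio (its number of bins is at most $\Pi_k$ times the optimal number of bins, plus $k$). *)

theory Defs
  imports Complex_Main
begin

datatype request = Request (start: nat) (finish: nat) (weight: real)

definition active :: "request \<Rightarrow> nat \<Rightarrow> bool" where
  "active r t \<longleftrightarrow> start r \<le> t \<and> t < finish r"

definition duration :: "request \<Rightarrow> nat" where
  "duration r = finish r - start r"

definition active_idx :: "request list \<Rightarrow> nat \<Rightarrow> nat set" where
  "active_idx rs t = {i. i < length rs \<and> active (rs ! i) t}"

text \<open>
  An instance is the list of its requests in order of arrival; requests with the same start time
  arrive one after the other, in list order. Requests are identified by their list position, so
  identical requests may occur. Endpoints are integral (the time steps are \<open>1, \<dots>, T\<close>),
  hence every length is at least \<open>1\<close>.
\<close>

definition dbp_instance :: "nat \<Rightarrow> request list \<Rightarrow> bool" where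
  "dbp_instance T rs \<longleftrightarrow>
     0 < T \<and>
     sorted (map start rs) \<and>
     (\<forall>r\<in>set rs. 1 \<le> start r \<and> start r < finish r \<and> finish r \<le> T + 1 \<and>
                 0 < weight r \<and> weight r \<le> 1) \<and>
     (\<forall>t\<in>{1..T}. \<exists>r\<in>set rs. active r t)"

definition uniform_size :: "request list \<Rightarrow> bool" where
  "uniform_size rs \<longleftrightarrow> (\<exists>g::nat. 1 \<le> g \<and> (\<forall>r\<in>set rs. weight r = 1 / real g))"

definition max_duration :: "request list \<Rightarrow> nat" where
  "max_duration rs = Max (duration ` set rs)"

definition load :: "request list \<Rightarrow> nat \<Rightarrow> nat" where
  "load rs t = nat \<lceil>\<Sum>i\<in>active_idx rs t. weight (rs ! i)\<rceil>"

definition avg_load :: "nat \<Rightarrow> request list \<Rightarrow> real" where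
  "avg_load T rs = (\<Sum>t=1..T. real (load rs t)) / real T"

text \<open>
  A schedule maps request positions to machines. There is an unlimited supply of machines, named
  by natural numbers; only times at which a machine is active are paid for.
\<close>

definition feasible :: "request list \<Rightarrow> (nat \<Rightarrow> nat) \<Rightarrow> bool" where
  "feasible rs \<sigma> \<longleftrightarrow>
     (\<forall>t m. (\<Sum>i\<in>{i \<in> active_idx rs t. \<sigma> i = m}. weight (rs ! i)) \<le> 1)"

definition cost :: "nat \<Rightarrow> request list \<Rightarrow> (nat \<Rightarrow> nat) \<Rightarrow> nat" where
  "cost T rs \<sigma> = (\<Sum>t=1..T. card (\<sigma> ` active_idx rs t))"

definition OPT :: "nat \<Rightarrow> request list \<Rightarrow> nat" where
  "OPT T rs = (LEAST c. \<exists>\<sigma>. feasible rs \<sigma> \<and> cost T rs \<sigma> = c)"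

definition avg_cost :: "nat \<Rightarrow> request list \<Rightarrow> (nat \<Rightarrow> nat) \<Rightarrow> real" where
  "avg_cost T rs \<sigma> = real (cost T rs \<sigma>) / real T"

definition OPT_avg :: "nat \<Rightarrow> request list \<Rightarrow> real" where
  "OPT_avg T rs = real (OPT T rs) / real T"

text \<open>
  A (deterministic) online algorithm with extra information of type \<open>'i\<close> is a function
  \<open>A\<close>: when a request arrives, \<open>A\<close> receives the extra information available at that
  time and the list of all requests that have arrived so far (the last one being the new request),
  and returns the machine for the new request. Its own earlier decisions need not be passed on.
  Extra information seen at earlier times is not passed on either; this only restricts the
  algorithm.
\<close>

type_synonym 'i online_alg = "'i \<Rightarrow> request list \<Rightarrow> nat"

definition online_schedule ::
    "'i online_alg \<Rightarrow> (nat \<Rightarrow> 'i) \<Rightarrow> request list \<Rightarrow> nat \<Rightarrow> nat" where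
  "online_schedule A info rs i = A (info (start (rs ! i))) (take (Suc i) rs)"

definition schedule_with_avg_load ::
    "real online_alg \<Rightarrow> nat \<Rightarrow> request list \<Rightarrow> nat \<Rightarrow> nat" where
  "schedule_with_avg_load A T rs = online_schedule A (\<lambda>t. avg_load T rs) rs"

definition future_loads :: "request list \<Rightarrow> nat \<Rightarrow> nat list" where
  "future_loads rs t = map (load rs) [t ..< t + max_duration rs]"

definition schedule_with_future_loads ::
    "nat list online_alg \<Rightarrow> request list \<Rightarrow> nat \<Rightarrow> nat" where
  "schedule_with_future_loads A rs = online_schedule A (future_loads rs) rs"

definition opt_bins :: "real list \<Rightarrow> nat" where
  "opt_bins xs = (LEAST m. \<exists>f :: nat \<Rightarrow> nat.
     (\<forall>i<length xs. f i < m) \<and>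
     (\<forall>b<m. (\<Sum>i\<in>{i. i < length xs \<and> f i = b}. xs ! i) \<le> 1))"

text \<open>Number of additional bins opened by Next-Fit when the current bin has level \<open>a\<close>.\<close>

fun next_fit_from :: "real \<Rightarrow> real list \<Rightarrow> nat" where
  "next_fit_from a [] = 0"
| "next_fit_from a (x # xs) =
     (if a + x \<le> 1 then next_fit_from (a + x) xs else Suc (next_fit_from x xs))"

fun next_fit :: "real list \<Rightarrow> nat" where
  "next_fit [] = 0"
| "next_fit (x # xs) = Suc (next_fit_from x xs)"

definition harmonic :: "nat \<Rightarrow> real list \<Rightarrow> nat" where
  "harmonic k xs =
     (\<Sum>j\<in>{1..<k}. next_fit (filter (\<lambda>x. 1 / real (j + 1) < x \<and> x \<le> 1 / real j) xs))
     + next_fit (filter (\<lambda>x. x \<le> 1 / real k) xs)"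

text \<open>
  This is \<open>\<Pi>\<^sub>k\<close>. The additive constant is arbitrary here; that \<open>c = k\<close> suffices
  for \<open>\<rho> = \<Pi>\<^sub>k\<close> follows by repeating the input.
\<close>

definition harmonic_ratio :: "nat \<Rightarrow> real" where
  "harmonic_ratio k = Inf {\<rho>. \<exists>c. \<forall>xs. set xs \<subseteq> {0<..1} \<longrightarrow>
     real (harmonic k xs) \<le> \<rho> * real (opt_bins xs) + c}"

end

theory Submission
  imports Defs "HOL-Library.Countable" "HOL-Library.Discrete_Functions"
begin

text \<open>
  Average load \<open>v\<close>: requests of length about \<open>2 ^ i\<close> are grouped by windows of their departure
  times, of width \<open>\<epsilon> 2 ^ i\<close> with \<open>\<epsilon> = min 1 (sqrt ((i + 1) / v))\<close>, and each group is packed by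
  Next-Fit (per size class of Harmonic). Before the window of a group begins nothing in it has
  departed, so there the machines of the group are exactly the bins of Next-Fit on active requests;
  within the window they cost at most an \<open>\<epsilon>\<close> fraction more. There remains one partially filled
  machine per group, that is, \<open>O(1 / \<epsilon>)\<close> per length class. Since \<open>\<epsilon>\<close> depends on the class, \<open>\<mu>\<close>
  need not be known: \<open>1 / \<epsilon>\<close> summed over \<open>i \<le> log \<mu>\<close> is \<open>O(sqrt (v log \<mu>))\<close>. For classes with
  \<open>i + 1 > v\<close> this count would be too large; there the first \<open>sqrt (v / (i + 1)) / 5\<close> of the size of
  each group goes to shared machines, and a group that needs more pays for its own partially filled
  machine with its volume.

  Future loads: requests are assigned to levels below the load vector, top-down as in the
  Kierstead--Trotter colouring of interval graphs. A request of size \<open>w\<close> is denied the next higher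
  level because of one of its times, and at that time its own level never carries total size
  \<open>1 + w\<close> or more. Of the requests of a level that are active at a common time, those whose such
  time lies before are all active at the latest of these times, and those whose time lies after at
  the earliest. Hence the total size on a level is bounded by a constant, and a constant number of
  machines per level suffices.
\<close>

section \<open>Loads and optimal schedules\<close>

definition total_weight :: "request list \<Rightarrow> nat \<Rightarrow> real" where
  "total_weight rs t = (\<Sum>i\<in>active_idx rs t. weight (rs ! i))"

lemma finite_active_idx [simp]: "finite (active_idx rs t)"
  by (simp add: active_idx_def)

lemma total_weight_le_load: "total_weight rs t \<le> real (load rs t)"
  unfolding total_weight_def load_def by linarith

lemma instance_request:
  assumes "dbp_instance T rs" and "i < length rs"
  shows "1 \<le> start (rs ! i)" "start (rs ! i) < finish (rs ! i)" "finish (rs ! i) \<le> T + 1"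
    "0 < weight (rs ! i)" "weight (rs ! i) \<le> 1"
  using assms nth_mem[OF assms(2)] unfolding dbp_instance_def by auto

lemma instance_start_mono:
  assumes "dbp_instance T rs" and "i \<le> j" and "j < length rs"
  shows "start (rs ! i) \<le> start (rs ! j)"
proof -
  have "sorted (map start rs)"
    using assms(1) by (simp add: dbp_instance_def)
  then have "map start rs ! i \<le> map start rs ! j"
    using assms by (intro sorted_nth_mono) auto
  then show ?thesis
    using assms by simp
qed

lemma feasible_iff:
  assumes "\<And>i. i < length rs \<Longrightarrow> 0 < weight (rs ! i)"
  shows "feasible rs \<sigma> \<longleftrightarrow>
    (\<forall>t m. (\<Sum>i<length rs. if active (rs ! i) t \<and> \<sigma> i = m then weight (rs ! i) else 0) \<le> 1)"
proof -
  have "(\<Sum>i\<in>{i \<in> active_idx rs t. \<sigma> i = m}. weight (rs ! i)) =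
      (\<Sum>i<length rs. if active (rs ! i) t \<and> \<sigma> i = m then weight (rs ! i) else 0)" for t m
    by (subst sum.inter_filter[symmetric]) (auto simp: active_idx_def intro!: sum.cong)
  then show ?thesis
    by (simp add: feasible_def)
qed

text \<open>Machines are first given structured names of a countable type. As \<open>to_nat\<close>
  is injective, capacity can be checked on those names; a number outside its range carries no
  request.\<close>

lemma feasible_to_natI:
  fixes M :: "nat \<Rightarrow> 'a::countable"
  assumes "\<And>i. i < length rs \<Longrightarrow> 0 < weight (rs ! i)"
    and \<sigma>: "\<And>i. i < length rs \<Longrightarrow> \<sigma> i = to_nat (M i)"
    and cap: "\<And>t m. (\<Sum>i<length rs. if active (rs ! i) t \<and> M i = m then weight (rs ! i) else 0) \<le> 1"
  shows "feasible rs \<sigma>"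
proof (subst feasible_iff[OF assms(1)], assumption, intro allI)
  fix t m
  show "(\<Sum>i<length rs. if active (rs ! i) t \<and> \<sigma> i = m then weight (rs ! i) else 0) \<le> 1"
  proof (cases "m \<in> range (to_nat :: 'a \<Rightarrow> nat)")
    case True
    then obtain m' :: 'a where "m = to_nat m'"
      by auto
    then have "(\<Sum>i<length rs. if active (rs ! i) t \<and> \<sigma> i = m then weight (rs ! i) else 0) =
        (\<Sum>i<length rs. if active (rs ! i) t \<and> M i = m' then weight (rs ! i) else 0)"
      using \<sigma> by (intro sum.cong) auto
    then show ?thesis
      using cap[of t m'] by simp
  next
    case False
    then have "(\<Sum>i<length rs. if active (rs ! i) t \<and> \<sigma> i = m then weight (rs ! i) else 0) = 0"
      using \<sigma> by (intro sum.neutral) auto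
    then show ?thesis
      by simp
  qed
qed

lemma card_to_nat_machines:
  fixes M :: "nat \<Rightarrow> 'a::countable"
  assumes "\<And>i. i < length rs \<Longrightarrow> \<sigma> i = to_nat (M i)"
  shows "card (\<sigma> ` active_idx rs t) = card (M ` active_idx rs t)"
proof -
  have "\<sigma> ` active_idx rs t = to_nat ` M ` active_idx rs t"
    unfolding image_image using assms by (intro image_cong) (auto simp: active_idx_def)
  then show ?thesis
    by (simp add: card_image)
qed

lemma total_weight_eq:
  "total_weight rs t = (\<Sum>i<length rs. if active (rs ! i) t then weight (rs ! i) else 0)"
  unfolding total_weight_def
  by (subst sum.inter_filter[symmetric]) (auto simp: active_idx_def intro!: sum.cong)

text \<open>Each machine carries total size at most 1, so the number of machines is an integer not
  below the total size; integrality gives the ceiling.\<close>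

lemma load_le_machines:
  assumes "feasible rs \<sigma>"
  shows "load rs t \<le> card (\<sigma> ` active_idx rs t)"
proof -
  have "(\<Sum>i\<in>active_idx rs t. weight (rs ! i)) =
      (\<Sum>m\<in>\<sigma> ` active_idx rs t. \<Sum>i\<in>{i \<in> active_idx rs t. \<sigma> i = m}. weight (rs ! i))"
    by (rule sum.image_gen) simp
  also have "\<dots> \<le> (\<Sum>m\<in>\<sigma> ` active_idx rs t. 1)"
    using assms by (intro sum_mono) (simp add: feasible_def)
  finally show ?thesis
    unfolding load_def by (simp add: ceiling_le_iff)
qed

lemma sum_load_le_cost:
  assumes "feasible rs \<sigma>"
  shows "(\<Sum>t=1..T. load rs t) \<le> cost T rs \<sigma>"
  unfolding cost_def by (intro sum_mono load_le_machines assms)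

lemma OPT_attained:
  assumes "dbp_instance T rs"
  obtains \<sigma> where "feasible rs \<sigma>" and "cost T rs \<sigma> = OPT T rs"
proof -
  \<comment> \<open>One machine per request is feasible, so the \<open>LEAST\<close> in
    \<open>OPT\<close> is taken over a nonempty set.\<close>
  have "feasible rs (\<lambda>i. i)"
    unfolding feasible_def
  proof (intro allI)
    fix t m
    have "{i \<in> active_idx rs t. i = m} = (if m \<in> active_idx rs t then {m} else {})"
      by auto
    then show "(\<Sum>i\<in>{i \<in> active_idx rs t. i = m}. weight (rs ! i)) \<le> 1"
      using instance_request(5)[OF assms] by (auto simp: active_idx_def)
  qed
  then have "\<exists>c. \<exists>\<sigma>. feasible rs \<sigma> \<and> cost T rs \<sigma> = c"
    by blast
  then have "\<exists>\<sigma>. feasible rs \<sigma> \<and> cost T rs \<sigma> = OPT T rs"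
    unfolding OPT_def by (rule LeastI_ex)
  then show thesis
    using that by blast
qed

lemma sum_load_le_OPT:
  assumes "dbp_instance T rs"
  shows "(\<Sum>t=1..T. load rs t) \<le> OPT T rs"
  using OPT_attained[OF assms] sum_load_le_cost by metis

lemma avg_load_le_OPT_avg:
  assumes "dbp_instance T rs"
  shows "avg_load T rs \<le> OPT_avg T rs"
proof -
  have "(\<Sum>t=1..T. real (load rs t)) \<le> real (OPT T rs)"
    using sum_load_le_OPT[OF assms] by (metis of_nat_le_iff of_nat_sum)
  then show ?thesis
    unfolding avg_load_def OPT_avg_def by (intro divide_right_mono) auto
qed

lemma avg_cost_le_if_le_load:
  assumes "dbp_instance T rs"
    and "\<And>t. t \<in> {1..T} \<Longrightarrow> card (\<sigma> ` active_idx rs t) \<le> c * load rs t"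
  shows "avg_cost T rs \<sigma> \<le> real c * OPT_avg T rs"
proof -
  have "cost T rs \<sigma> \<le> (\<Sum>t=1..T. c * load rs t)"
    unfolding cost_def using assms(2) by (intro sum_mono) auto
  also have "\<dots> = c * (\<Sum>t=1..T. load rs t)"
    by (simp add: sum_distrib_left)
  also have "\<dots> \<le> c * OPT T rs"
    using sum_load_le_OPT[OF assms(1)] by simp
  finally have "real (cost T rs \<sigma>) \<le> real c * real (OPT T rs)"
    by (metis of_nat_le_iff of_nat_mult)
  then show ?thesis
    unfolding avg_cost_def OPT_avg_def by (simp add: divide_right_mono)
qed

section \<open>Layering intervals below the load vector\<close>

text \<open>
  With the load \<open>U d\<close> at time \<open>d\<close> viewed as levels \<open>0, 1, \<dots>\<close> below height \<open>U d\<close>, the items of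
  level at least \<open>c\<close> may together weigh at most the height \<open>U d - c\<close> that is left to them.
\<close>

function level :: "(nat \<Rightarrow> real) \<Rightarrow> (nat \<Rightarrow> nat \<Rightarrow> bool) \<Rightarrow> (nat \<Rightarrow> real) \<Rightarrow> nat \<Rightarrow> nat" where
  "level U a w i = (GREATEST m. \<forall>c\<le>m. \<forall>d. a i d \<longrightarrow>
     (\<Sum>j<i. if a j d \<and> c \<le> level U a w j then w j else 0) + w i \<le> U d - real c)"
  by pat_completeness auto
termination
  by (relation "measure (\<lambda>(_, _, _, i). i)") auto

declare level.simps [simp del]

text \<open>The level depends only on the items up to \<open>i\<close> and on \<open>U\<close> at
  the times they cover. This restricted dependence is what makes levels computable online.\<close>

lemma level_cong:
  assumes "\<And>j d. j \<le> i \<Longrightarrow> a j d = a' j d" and "\<And>j. j \<le> i \<Longrightarrow> w j = w' j"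
    and "\<And>j d. j \<le> i \<Longrightarrow> a j d \<Longrightarrow> U d = U' d"
  shows "level U a w i = level U' a' w' i"
  using assms
proof (induction i rule: less_induct)
  case (less i)
  have IH: "level U a w j = level U' a' w' j" if "j < i" for j
  proof (rule less.IH[OF that])
    show "U d = U' d" if "k \<le> j" "a k d" for k d
      using less.prems(3)[of k d] that \<open>j < i\<close> by simp
  qed (use that less.prems in auto)
  have "(\<Sum>j<i. if a j d \<and> c \<le> level U a w j then w j else 0) =
      (\<Sum>j<i. if a' j d \<and> c \<le> level U' a' w' j then w' j else 0)" for c d
    using IH less.prems(1,2) by (intro sum.cong) auto
  then have "(\<forall>c\<le>m. \<forall>d. a i d \<longrightarrow>
      (\<Sum>j<i. if a j d \<and> c \<le> level U a w j then w j else 0) + w i \<le> U d - real c) \<longleftrightarrow>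
    (\<forall>c\<le>m. \<forall>d. a' i d \<longrightarrow>
      (\<Sum>j<i. if a' j d \<and> c \<le> level U' a' w' j then w' j else 0) + w' i \<le> U' d - real c)" for m
    using less.prems(1)[of i] less.prems(2)[of i] less.prems(3)[of i] by (intro all_cong1) auto
  then show ?case
    by (subst (1 2) level.simps) simp
qed

text \<open>First-Fit inside a level. Fit is tested only at the start time \<open>s i\<close>: items
  arrive in order of start time, so an earlier item that meets item \<open>i\<close> at a later time
  is already active at \<open>s i\<close>.\<close>

function bin :: "(nat \<Rightarrow> nat) \<Rightarrow> (nat \<Rightarrow> nat) \<Rightarrow> (nat \<Rightarrow> nat \<Rightarrow> bool) \<Rightarrow> (nat \<Rightarrow> real) \<Rightarrow> nat \<Rightarrow> nat" where
  "bin l s a w i = (LEAST b.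
     (\<Sum>j<i. if a j (s i) \<and> l j = l i \<and> bin l s a w j = b then w j else 0) + w i \<le> 1)"
  by pat_completeness auto
termination
  by (relation "measure (\<lambda>(_, _, _, _, i). i)") auto

declare bin.simps [simp del]

lemma bin_cong:
  assumes "\<And>j. j \<le> i \<Longrightarrow> l j = l' j" and "\<And>j. j \<le> i \<Longrightarrow> s j = s' j"
    and "\<And>j d. j \<le> i \<Longrightarrow> a j d = a' j d" and "\<And>j. j \<le> i \<Longrightarrow> w j = w' j"
  shows "bin l s a w i = bin l' s' a' w' i"
  using assms
proof (induction i rule: less_induct)
  case (less i)
  have IH: "bin l s a w j = bin l' s' a' w' j" if "j < i" for j
    using that less.prems by (intro less.IH) auto
  have "(\<Sum>j<i. if a j (s i) \<and> l j = l i \<and> bin l s a w j = b then w j else 0) =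
      (\<Sum>j<i. if a' j (s' i) \<and> l' j = l' i \<and> bin l' s' a' w' j = b then w' j else 0)" for b
    using IH less.prems by (intro sum.cong) auto
  then show ?case
    using less.prems by (subst (1 2) bin.simps) simp
qed

text \<open>Split the items through \<open>t\<close> by the side on which \<open>D j\<close> lies.
  By convexity every item of the left half contains the latest of its points \<open>D j\<close>, and
  every item of the right half the earliest; each half weighs at most \<open>\<beta>\<close>, whence
  the factor 2.\<close>

lemma interval_family_bound:
  fixes a :: "nat \<Rightarrow> nat \<Rightarrow> bool" and w :: "nat \<Rightarrow> real"
  assumes fin: "finite X" and nonneg: "\<And>j. j \<in> X \<Longrightarrow> 0 \<le> w j"
    and convex: "\<And>j x y z. j \<in> X \<Longrightarrow> a j x \<Longrightarrow> a j z \<Longrightarrow> x \<le> y \<Longrightarrow> y \<le> z \<Longrightarrow> a j y"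
    and D: "\<And>i. i \<in> X \<Longrightarrow> a i (D i) \<and> sum w {j \<in> X. a j (D i)} \<le> \<beta>"
    and "0 \<le> \<beta>"
  shows "sum w {j \<in> X. a j t} \<le> 2 * \<beta>"
proof -
  define L where "L = {j \<in> X. a j t \<and> D j \<le> t}"
  define R where "R = {j \<in> X. a j t \<and> t < D j}"
  have [simp]: "finite L" "finite R"
    using fin by (auto simp: L_def R_def)
  have "sum w L \<le> \<beta>"
  proof (cases "L = {}")
    case False
    then have "Max (D ` L) \<in> D ` L"
      by (intro Max_in) auto
    then obtain i where i: "i \<in> L" "Max (D ` L) = D i"
      by auto
    have "a j (D i)" if "j \<in> L" for j
    proof -
      have "D j \<le> D i"
        using that i(2) Max_ge[of "D ` L" "D j"] by simp
      then show ?thesis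
        using that i(1) D convex[of j "D j" t "D i"] by (auto simp: L_def)
    qed
    then have "sum w L \<le> sum w {j \<in> X. a j (D i)}"
      using fin nonneg by (intro sum_mono2) (auto simp: L_def)
    then show ?thesis
      using D[of i] i(1) by (auto simp: L_def)
  qed (simp add: \<open>0 \<le> \<beta>\<close>)
  moreover have "sum w R \<le> \<beta>"
  proof (cases "R = {}")
    case False
    then have "Min (D ` R) \<in> D ` R"
      by (intro Min_in) auto
    then obtain i where i: "i \<in> R" "Min (D ` R) = D i"
      by auto
    have "a j (D i)" if "j \<in> R" for j
    proof -
      have "D i \<le> D j"
        using that i(2) Min_le[of "D ` R" "D j"] by simp
      then show ?thesis
        using that i(1) D convex[of j t "D j" "D i"] by (auto simp: R_def)
    qed
    then have "sum w R \<le> sum w {j \<in> X. a j (D i)}"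
      using fin nonneg by (intro sum_mono2) (auto simp: R_def)
    then show ?thesis
      using D[of i] i(1) by (auto simp: R_def)
  qed (simp add: \<open>0 \<le> \<beta>\<close>)
  moreover have "{j \<in> X. a j t} = L \<union> R" and "L \<inter> R = {}"
    by (auto simp: L_def R_def)
  ultimately show ?thesis
    by (simp add: sum.union_disjoint)
qed

text \<open>Weights are only nonnegative because requests above the size threshold stay in the list
  with weight 0, so that list positions are preserved.\<close>

locale interval_packing =
  fixes n :: nat and s e :: "nat \<Rightarrow> nat" and w :: "nat \<Rightarrow> real" and U :: "nat \<Rightarrow> real"
  assumes start_mono: "\<And>i j. i \<le> j \<Longrightarrow> j < n \<Longrightarrow> s i \<le> s j"
    and nonempty: "\<And>i. i < n \<Longrightarrow> s i < e i"
    and nonneg: "\<And>i. i < n \<Longrightarrow> 0 \<le> w i"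
    and below_U: "\<And>d. (\<Sum>j<n. if s j \<le> d \<and> d < e j then w j else 0) \<le> U d"
begin

abbreviation a :: "nat \<Rightarrow> nat \<Rightarrow> bool" where
  "a i d \<equiv> s i \<le> d \<and> d < e i"

abbreviation lv :: "nat \<Rightarrow> nat" where
  "lv \<equiv> level U a w"

lemma sum_if_mono:
  assumes "m \<le> n" and "\<And>j. j < m \<Longrightarrow> P j \<Longrightarrow> Q j"
  shows "(\<Sum>j<m. if P j then w j else 0) \<le> (\<Sum>j<n. if Q j then w j else 0)"
proof -
  have "(\<Sum>j<m. if P j then w j else 0) \<le> (\<Sum>j<m. if Q j then w j else 0)"
    using assms nonneg by (intro sum_mono) auto
  also have "\<dots> \<le> (\<Sum>j<n. if Q j then w j else 0)"
    using assms nonneg by (intro sum_mono2) auto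
  finally show ?thesis .
qed

lemma sum_if_Suc_le:
  assumes "i < n" and "Q i" and "\<And>j. j < i \<Longrightarrow> P j \<Longrightarrow> Q j"
  shows "(\<Sum>j<i. if P j then w j else 0) + w i \<le> (\<Sum>j<n. if Q j then w j else 0)"
proof -
  have "(\<Sum>j<i. if P j then w j else 0) + w i = (\<Sum>j<Suc i. if j = i \<or> P j then w j else 0)"
    by simp
  also have "\<dots> \<le> (\<Sum>j<n. if Q j then w j else 0)"
    using assms by (intro sum_if_mono) (auto simp: less_Suc_eq)
  finally show ?thesis .
qed

lemma level_properties:
  assumes "i < n"
  shows level_fits: "\<And>c d. c \<le> lv i \<Longrightarrow> a i d \<Longrightarrow>
      (\<Sum>j<i. if a j d \<and> c \<le> lv j then w j else 0) + w i \<le> U d - real c"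
    and level_tight: "\<exists>d. a i d \<and>
      (\<Sum>j<i. if a j d \<and> Suc (lv i) \<le> lv j then w j else 0) + w i > U d - real (Suc (lv i))"
proof -
  define P where "P m \<longleftrightarrow> (\<forall>c\<le>m. \<forall>d. a i d \<longrightarrow>
     (\<Sum>j<i. if a j d \<and> c \<le> lv j then w j else 0) + w i \<le> U d - real c)" for m
  have lv: "lv i = (GREATEST m. P m)"
    unfolding P_def by (subst level.simps) simp
  \<comment> \<open>The \<open>GREATEST\<close> is meaningful: level 0 is allowed because
    \<open>U\<close> bounds the whole load, and \<open>U (s i)\<close> bounds all allowed
    levels.\<close>
  have "P 0"
    unfolding P_def
  proof (intro allI impI)
    fix c d
    assume "c \<le> (0::nat)" and "a i d"
    then have "(\<Sum>j<i. if a j d \<and> c \<le> lv j then w j else 0) + w i \<le> (\<Sum>j<n. if a j d then w j else 0)"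
      using assms by (intro sum_if_Suc_le) auto
    then show "(\<Sum>j<i. if a j d \<and> c \<le> lv j then w j else 0) + w i \<le> U d - real c"
      using \<open>c \<le> 0\<close> below_U[of d] by simp
  qed
  moreover have bound: "m \<le> nat \<lceil>U (s i)\<rceil>" if "P m" for m
  proof -
    have "0 \<le> (\<Sum>j<i. if a j (s i) \<and> m \<le> lv j then w j else 0) + w i"
      using nonneg assms by (intro add_nonneg_nonneg sum_nonneg) auto
    also have "\<dots> \<le> U (s i) - real m"
      using that nonempty[OF assms] by (auto simp: P_def)
    finally show ?thesis
      by linarith
  qed
  ultimately have Pl: "P (lv i)" and max: "\<And>m. P m \<Longrightarrow> m \<le> lv i"
    unfolding lv using GreatestI_nat[of P 0] Greatest_le_nat[of P] by blast+
  show "\<And>c d. c \<le> lv i \<Longrightarrow> a i d \<Longrightarrow>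
      (\<Sum>j<i. if a j d \<and> c \<le> lv j then w j else 0) + w i \<le> U d - real c"
    using Pl unfolding P_def by blast
  have "\<not> P (Suc (lv i))"
    using max[of "Suc (lv i)"] by auto
  then obtain c d where cd: "c \<le> Suc (lv i)" "a i d"
      "\<not> (\<Sum>j<i. if a j d \<and> c \<le> lv j then w j else 0) + w i \<le> U d - real c"
    unfolding P_def by blast
  \<comment> \<open>All smaller \<open>c\<close> satisfy the condition by \<open>Pl\<close>, so the
    next level is blocked at exactly its own height.\<close>
  moreover have "c = Suc (lv i)"
    using cd Pl unfolding P_def by (meson le_SucE)
  ultimately show "\<exists>d. a i d \<and>
      (\<Sum>j<i. if a j d \<and> Suc (lv i) \<le> lv j then w j else 0) + w i > U d - real (Suc (lv i))"
    by (intro exI[of _ d]) auto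
qed

lemma level_less:
  assumes "i < n" and "0 < w i" and "a i d"
  shows "real (lv i) < U d"
proof -
  have "0 \<le> (\<Sum>j<i. if a j d \<and> lv i \<le> lv j then w j else 0)"
    using nonneg assms by (intro sum_nonneg) auto
  then show ?thesis
    using level_fits[OF assms(1) order.refl assms(3)] assms(2) by linarith
qed

text \<open>\<open>level_fits\<close> speaks only of the moment of insertion. The last item of level
  at least \<open>c\<close> that is active at \<open>d\<close> sees all the others, so its insertion
  bound holds for the complete family.\<close>

lemma layer_total:
  assumes "i < n" and "a i d" and "c \<le> lv i"
  shows "(\<Sum>j<n. if a j d \<and> c \<le> lv j then w j else 0) \<le> U d - real c"
proof -
  define A where "A = {j. j < n \<and> a j d \<and> c \<le> lv j}"
  have "finite A" "A \<noteq> {}"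
    using assms by (auto simp: A_def)
  then have k: "Max A \<in> A" and max: "\<And>j. j \<in> A \<Longrightarrow> j \<le> Max A"
    by auto
  define k where "k = Max A"
  have "(\<Sum>j<n. if a j d \<and> c \<le> lv j then w j else 0) =
      (\<Sum>j<Suc k. if a j d \<and> c \<le> lv j then w j else 0)"
  proof (rule sum.mono_neutral_right)
    show "\<forall>j\<in>{..<n} - {..<Suc k}. (if a j d \<and> c \<le> lv j then w j else 0) = 0"
    proof
      fix j assume "j \<in> {..<n} - {..<Suc k}"
      then have "j < n" "j \<notin> A"
        using max[of j] by (auto simp: k_def)
      then show "(if a j d \<and> c \<le> lv j then w j else 0) = 0"
        by (auto simp: A_def)
    qed
  qed (use k in \<open>auto simp: A_def k_def\<close>)
  also have "\<dots> = (\<Sum>j<k. if a j d \<and> c \<le> lv j then w j else 0) + w k"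
    using k by (simp add: A_def k_def)
  also have "\<dots> \<le> U d - real c"
    using k by (intro level_fits) (auto simp: A_def k_def)
  finally show ?thesis .
qed

text \<open>At the time \<open>d\<close> that blocked the next level, the items above level
  \<open>lv i\<close> weigh more than \<open>U d - lv i - 1 - w i\<close>, while those at or above
  it weigh at most \<open>U d - lv i\<close>. The difference is less than
  \<open>1 + w i\<close>.\<close>

lemma level_witness:
  assumes "i < n"
  shows "\<exists>d. a i d \<and> (\<Sum>j<n. if a j d \<and> lv j = lv i then w j else 0) < 1 + w i"
proof -
  obtain d where d: "a i d"
      "(\<Sum>j<i. if a j d \<and> Suc (lv i) \<le> lv j then w j else 0) + w i > U d - real (Suc (lv i))"
    using level_tight[OF assms] by blast
  let ?S = "\<lambda>P. \<Sum>j<n. if a j d \<and> P (lv j) then w j else 0"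
  have "?S (\<lambda>l. l = lv i) + ?S (\<lambda>l. Suc (lv i) \<le> l) = ?S (\<lambda>l. lv i \<le> l)"
    unfolding sum.distrib[symmetric] by (intro sum.cong) auto
  moreover have "?S (\<lambda>l. lv i \<le> l) \<le> U d - real (lv i)"
    using assms d(1) by (intro layer_total) auto
  moreover have "(\<Sum>j<i. if a j d \<and> Suc (lv i) \<le> lv j then w j else 0) \<le> ?S (\<lambda>l. Suc (lv i) \<le> l)"
    using assms by (intro sum_if_mono) auto
  ultimately have "?S (\<lambda>l. l = lv i) < 1 + w i"
    using d(2) by simp
  then show ?thesis
    using d(1) by blast
qed

text \<open>The strict bound \<open>1 + w i\<close> is left for the caller to turn into
  \<open>\<beta>\<close>: into 1 by integrality for uniform sizes, into 3/2 for sizes at most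
  1/2.\<close>

lemma level_weight_bound:
  assumes "\<And>i d. i < n \<Longrightarrow> 0 < w i \<Longrightarrow> a i d \<Longrightarrow>
      (\<Sum>j<n. if a j d \<and> lv j = lv i then w j else 0) < 1 + w i \<Longrightarrow>
      (\<Sum>j<n. if a j d \<and> lv j = lv i then w j else 0) \<le> \<beta>"
    and "0 \<le> \<beta>"
  shows "(\<Sum>j<n. if a j t \<and> lv j = m then w j else 0) \<le> 2 * \<beta>"
proof -
  define X where "X = {j. j < n \<and> 0 < w j \<and> lv j = m}"
  have eq: "(\<Sum>j<n. if a j d \<and> lv j = m then w j else 0) = sum w {j \<in> X. a j d}" for d
  proof -
    have "sum w {j \<in> X. a j d} = (\<Sum>j<n. if j \<in> X \<and> a j d then w j else 0)"
      by (subst sum.inter_filter[symmetric]) (auto simp: X_def intro!: sum.cong)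
    also have "\<dots> = (\<Sum>j<n. if a j d \<and> lv j = m then w j else 0)"
      using nonneg by (intro sum.cong) (auto simp: X_def order.order_iff_strict)
    finally show ?thesis by simp
  qed
  have "\<exists>d. a i d \<and> sum w {j \<in> X. a j d} \<le> \<beta>" if "i \<in> X" for i
    using level_witness[of i] assms(1)[of i] that unfolding eq[symmetric] by (auto simp: X_def)
  then obtain D where "\<And>i. i \<in> X \<Longrightarrow> a i (D i) \<and> sum w {j \<in> X. a j (D i)} \<le> \<beta>"
    by metis
  then have "sum w {j \<in> X. a j t} \<le> 2 * \<beta>"
    using nonneg assms(2) by (intro interval_family_bound[where a = a and D = D]) (auto simp: X_def)
  then show ?thesis
    by (simp only: eq)
qed

section \<open>First-Fit inside a level\<close>

abbreviation bn :: "nat \<Rightarrow> nat" where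
  "bn \<equiv> bin lv s a w"

definition bin_load :: "nat \<Rightarrow> nat \<Rightarrow> real" where
  "bin_load i b = (\<Sum>j<i. if a j (s i) \<and> lv j = lv i \<and> bn j = b then w j else 0)"

lemma bin_fits:
  assumes "i < n" and "\<exists>b<B. bin_load i b + w i \<le> 1"
  shows "bn i < B" and "bin_load i (bn i) + w i \<le> 1"
proof -
  have bn: "bn i = (LEAST b. bin_load i b + w i \<le> 1)"
    unfolding bin_load_def by (subst bin.simps) simp
  obtain b where b: "b < B" "bin_load i b + w i \<le> 1"
    using assms(2) by blast
  show "bin_load i (bn i) + w i \<le> 1"
    unfolding bn using b(2) by (rule LeastI)
  show "bn i < B"
    unfolding bn using Least_le[of "\<lambda>b. bin_load i b + w i \<le> 1", OF b(2)] b(1) by linarith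
qed

text \<open>Consider the last arrival among the items active on the machine at time
  \<open>t\<close>. All the others were present at its start, where its fit was tested.\<close>

lemma machine_capacity:
  assumes "\<And>i. i < n \<Longrightarrow> 0 < w i \<Longrightarrow> bin_load i (bn i) + w i \<le> 1"
  shows "(\<Sum>j<n. if a j t \<and> lv j = m \<and> bn j = b then w j else 0) \<le> 1"
proof -
  define A where "A = {j. j < n \<and> 0 < w j \<and> a j t \<and> lv j = m \<and> bn j = b}"
  show ?thesis
  proof (cases "A = {}")
    case True
    then have "(\<Sum>j<n. if a j t \<and> lv j = m \<and> bn j = b then w j else 0) = 0"
      using nonneg by (intro sum.neutral) (auto simp: A_def order.order_iff_strict)
    then show ?thesis by simp
  next
    case False
    have "finite A"
      by (simp add: A_def)
    then have k: "Max A \<in> A" and max: "\<And>j. j \<in> A \<Longrightarrow> j \<le> Max A"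
      using False by auto
    define k where "k = Max A"
    have "(\<Sum>j<n. if a j t \<and> lv j = m \<and> bn j = b then w j else 0) =
        (\<Sum>j<Suc k. if a j t \<and> lv j = m \<and> bn j = b then w j else 0)"
    proof (rule sum.mono_neutral_right)
      show "\<forall>j\<in>{..<n} - {..<Suc k}. (if a j t \<and> lv j = m \<and> bn j = b then w j else 0) = 0"
      proof
        fix j assume "j \<in> {..<n} - {..<Suc k}"
        then have "j < n" "j \<notin> A"
          using max[of j] by (auto simp: k_def)
        then show "(if a j t \<and> lv j = m \<and> bn j = b then w j else 0) = 0"
          using nonneg[of j] by (auto simp: A_def)
      qed
    qed (use k in \<open>auto simp: A_def k_def\<close>)
    also have "\<dots> = (\<Sum>j<k. if a j t \<and> lv j = m \<and> bn j = b then w j else 0) + w k"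
      using k by (simp add: A_def k_def)
    also have "\<dots> \<le> bin_load k (bn k) + w k"
      unfolding bin_load_def
    proof (intro add_right_mono sum_mono)
      fix j assume "j \<in> {..<k}"
      then have "s j \<le> s k" "0 \<le> w j"
        using k start_mono[of j k] nonneg[of j] by (auto simp: A_def k_def)
      then show "(if a j t \<and> lv j = m \<and> bn j = b then w j else 0)
          \<le> (if a j (s k) \<and> lv j = lv k \<and> bn j = bn k then w j else 0)"
        using k by (auto simp: A_def k_def)
    qed
    also have "\<dots> \<le> 1"
      using k assms[of k] by (simp add: A_def k_def)
    finally show ?thesis .
  qed
qed

lemma bins_le_level:
  assumes "i < n"
  shows "(\<Sum>b<B. bin_load i b) + w i \<le> (\<Sum>j<n. if a j (s i) \<and> lv j = lv i then w j else 0)"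
proof -
  have "(\<Sum>b<B. bin_load i b) =
      (\<Sum>j<i. \<Sum>b<B. if a j (s i) \<and> lv j = lv i \<and> bn j = b then w j else 0)"
    unfolding bin_load_def by (rule sum.swap)
  also have "\<dots> \<le> (\<Sum>j<i. if a j (s i) \<and> lv j = lv i then w j else 0)"
  proof (rule sum_mono)
    fix j assume "j \<in> {..<i}"
    have "(\<Sum>b<B. if a j (s i) \<and> lv j = lv i \<and> bn j = b then w j else 0) =
        (\<Sum>b<B. if bn j = b then (if a j (s i) \<and> lv j = lv i then w j else 0) else 0)"
      by (intro sum.cong) auto
    also have "\<dots> \<le> (if a j (s i) \<and> lv j = lv i then w j else 0)"
      using nonneg[of j] assms \<open>j \<in> {..<i}\<close> by (simp add: sum.delta)
    finally show "(\<Sum>b<B. if a j (s i) \<and> lv j = lv i \<and> bn j = b then w j else 0)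
        \<le> (if a j (s i) \<and> lv j = lv i then w j else 0)" .
  qed
  finally show ?thesis
    using sum_if_Suc_le[OF assms, of "\<lambda>j. a j (s i) \<and> lv j = lv i" "\<lambda>j. a j (s i) \<and> lv j = lv i"]
      nonempty[OF assms] by simp
qed

lemma bin_exists_small:
  assumes "\<And>j. j < n \<Longrightarrow> w j \<le> 1 / 2" and "i < n"
  shows "\<exists>b<5. bin_load i b + w i \<le> 1"
proof (rule ccontr)
  assume "\<not> ?thesis"
  then have "\<And>b. b < 5 \<Longrightarrow> 1 - w i \<le> bin_load i b" and "1 - w i < bin_load i 0"
    by (force simp: not_le)+
  then have "(\<Sum>b<(5::nat). 1 - w i) < (\<Sum>b<5. bin_load i b)"
    by (intro sum_strict_mono_ex1) (auto intro!: bexI[of _ 0])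
  \<comment> \<open>Five rejecting bins and the item weigh more than \<open>5 - 4 * w i\<close>,
    which is at least 3 as \<open>w i\<close> is at most 1/2; but the level carries at most
    3.\<close>
  then have "5 * (1 - w i) + w i < (\<Sum>j<n. if a j (s i) \<and> lv j = lv i then w j else 0)"
    using bins_le_level[OF assms(2), of 5] by simp
  also have "\<dots> \<le> 2 * (3 / 2)"
  proof (rule level_weight_bound)
    fix i d
    assume "i < n" and "(\<Sum>j<n. if a j d \<and> lv j = lv i then w j else 0) < 1 + w i"
    then show "(\<Sum>j<n. if a j d \<and> lv j = lv i then w j else 0) \<le> 3 / 2"
      using assms(1)[of i] by linarith
  qed simp
  finally show False
    using assms(1)[OF assms(2)] by simp
qed

text \<open>All sums are multiples of \<open>1 / g\<close>, so strict inequalities round: a bin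
  rejecting the item has load at least 1, and a level weighing less than \<open>1 + 1 / g\<close> at
  a time weighs at most 1 there. Hence the level carries at most 2, too little for two full bins and
  one more item.\<close>

lemma bin_exists_uniform:
  assumes "1 \<le> g" and "\<And>j. j < n \<Longrightarrow> w j = 1 / real g" and "i < n"
  shows "\<exists>b<2. bin_load i b + w i \<le> 1"
proof (rule ccontr)
  have mult: "\<exists>k::nat. (\<Sum>j<m. if P j then w j else 0) = real k / real g" if "m \<le> n" for P m
  proof -
    have "(\<Sum>j<m. if P j then w j else 0) = (\<Sum>j<m. (if P j then 1 else 0) / real g)"
      using assms that by (intro sum.cong) auto
    also have "\<dots> = real (\<Sum>j<m. if P j then 1 else 0) / real g"
      by (simp add: sum_divide_distrib of_nat_sum if_distrib cong: if_cong)
    finally show ?thesis by blast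
  qed
  have round: "x \<ge> 1" if gt: "x + 1 / real g > 1" and ex: "\<exists>k::nat. x = real k / real g" for x
  proof -
    obtain k :: nat where k: "x = real k / real g"
      using ex by blast
    then have "real (k + 1) > real g"
      using gt assms(1) by (simp add: field_simps)
    then have "real k \<ge> real g"
      unfolding of_nat_less_iff of_nat_le_iff by simp
    then show ?thesis
      unfolding k using assms(1) by (simp add: field_simps)
  qed
  assume *: "\<not> ?thesis"
  have "bin_load i b \<ge> 1" if "b < 2" for b
  proof (rule round)
    show "bin_load i b + 1 / real g > 1"
      using * that assms by (simp add: not_le)
    show "\<exists>k::nat. bin_load i b = real k / real g"
      unfolding bin_load_def using assms by (intro mult) auto
  qed
  then have "2 \<le> (\<Sum>b<2. bin_load i b)"
    using sum_mono[of "{..<2}" "\<lambda>_. 1" "bin_load i"] by simp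
  moreover have "0 < w i"
    using assms by simp
  ultimately have "2 < (\<Sum>b<2. bin_load i b) + w i"
    by linarith
  also have "\<dots> \<le> (\<Sum>j<n. if a j (s i) \<and> lv j = lv i then w j else 0)"
    by (rule bins_le_level) fact
  also have "\<dots> \<le> 2 * 1"
  proof (rule level_weight_bound)
    fix i d
    assume i: "i < n" and less: "(\<Sum>j<n. if a j d \<and> lv j = lv i then w j else 0) < 1 + w i"
    obtain k :: nat where k: "(\<Sum>j<n. if a j d \<and> lv j = lv i then w j else 0) = real k / real g"
      using mult[OF order.refl, of "\<lambda>j. a j d \<and> lv j = lv i"] by blast
    have "real k < real (g + 1)"
      using less i assms unfolding k by (simp add: field_simps)
    then have "real k \<le> real g"
      unfolding of_nat_less_iff of_nat_le_iff by simp
    then show "(\<Sum>j<n. if a j d \<and> lv j = lv i then w j else 0) \<le> 1"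
      unfolding k using assms(1) by (simp add: field_simps)
  qed simp
  finally show False by simp
qed

end

section \<open>The algorithm for the future load vector\<close>

definition small_weight :: "real \<Rightarrow> request list \<Rightarrow> nat \<Rightarrow> real" where
  "small_weight \<theta> rs i = (if weight (rs ! i) \<le> \<theta> then weight (rs ! i) else 0)"

definition small_level :: "real \<Rightarrow> (nat \<Rightarrow> real) \<Rightarrow> request list \<Rightarrow> nat \<Rightarrow> nat" where
  "small_level \<theta> U rs = level U (\<lambda>j d. start (rs ! j) \<le> d \<and> d < finish (rs ! j)) (small_weight \<theta> rs)"

definition small_bin :: "real \<Rightarrow> (nat \<Rightarrow> real) \<Rightarrow> request list \<Rightarrow> nat \<Rightarrow> nat" where
  "small_bin \<theta> U rs = bin (small_level \<theta> U rs) (\<lambda>j. start (rs ! j))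
     (\<lambda>j d. start (rs ! j) \<le> d \<and> d < finish (rs ! j)) (small_weight \<theta> rs)"

text \<open>The threshold is 1 for uniform sizes, where nothing exceeds it, and 1/2 in general; a
  request above it gets the machine \<open>Inr i\<close> for itself.\<close>

definition machine :: "real \<Rightarrow> (nat \<Rightarrow> real) \<Rightarrow> request list \<Rightarrow> nat \<Rightarrow> (nat \<times> nat) + nat" where
  "machine \<theta> U rs i =
     (if weight (rs ! i) \<le> \<theta> then Inl (small_level \<theta> U rs i, small_bin \<theta> U rs i) else Inr i)"

text \<open>
  Everything active before the current time has already arrived, so the past loads, which the
  information no longer contains, can be recomputed.
\<close>

definition known_load :: "nat list \<Rightarrow> request list \<Rightarrow> nat \<Rightarrow> real" where
  "known_load info rs t =
     real (if t < start (last rs) then load rs t else info ! (t - start (last rs)))"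

definition future_load_alg :: "real \<Rightarrow> nat list online_alg" where
  "future_load_alg \<theta> info rs = to_nat (machine \<theta> (known_load info rs) rs (length rs - 1))"

lemma machine_cong:
  assumes "\<And>j. j \<le> i \<Longrightarrow> rs ! j = rs' ! j"
    and U: "\<And>j d. j \<le> i \<Longrightarrow> start (rs ! j) \<le> d \<Longrightarrow> d < finish (rs ! j) \<Longrightarrow> U d = U' d"
  shows "machine \<theta> U rs i = machine \<theta> U' rs' i"
proof -
  have w: "small_weight \<theta> rs j = small_weight \<theta> rs' j" if "j \<le> i" for j
    using assms(1)[OF that] by (simp add: small_weight_def)
  have l: "small_level \<theta> U rs j = small_level \<theta> U' rs' j" if "j \<le> i" for j
    unfolding small_level_def
  proof (rule level_cong)
    show "U d = U' d" if "k \<le> j" "start (rs ! k) \<le> d \<and> d < finish (rs ! k)" for k d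
      using U[of k d] that \<open>j \<le> i\<close> by simp
  qed (use assms(1) w that in auto)
  have "small_bin \<theta> U rs i = small_bin \<theta> U' rs' i"
    unfolding small_bin_def by (rule bin_cong) (use assms(1) w l in auto)
  then show ?thesis
    using l[of i] assms(1)[of i] by (simp add: machine_def)
qed

lemma duration_le_max_duration:
  assumes "i < length rs"
  shows "duration (rs ! i) \<le> max_duration rs"
  unfolding max_duration_def using assms by (intro Max_ge) auto

text \<open>A request active before the start of request \<open>i\<close> starts before it, and so
  precedes it in the sorted list.\<close>

lemma load_take_eq:
  assumes "dbp_instance T rs" and "i < length rs" and "t < start (rs ! i)"
  shows "load (take (Suc i) rs) t = load rs t"
proof -
  have "j \<le> i" if "j < length rs" "active (rs ! j) t" for j
    using instance_start_mono[OF assms(1), of i j] that assms(3)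
    by (fastforce simp: active_def)
  then have "active_idx (take (Suc i) rs) t = active_idx rs t"
    using assms(2) by (auto simp: active_idx_def less_Suc_eq_le)
  moreover have "take (Suc i) rs ! j = rs ! j" if "j \<in> active_idx (take (Suc i) rs) t" for j
    using that by (auto simp: active_idx_def)
  ultimately show ?thesis
    unfolding load_def by (metis (no_types, lifting) sum.cong)
qed

lemma future_load_schedule:
  assumes "dbp_instance T rs" and "i < length rs"
  shows "schedule_with_future_loads (future_load_alg \<theta>) rs i =
    to_nat (machine \<theta> (\<lambda>t. real (load rs t)) rs i)"
proof -
  let ?s = "start (rs ! i)" and ?pre = "take (Suc i) rs"
  have last: "last ?pre = rs ! i" and len: "length ?pre - 1 = i"
    using assms(2) by (auto simp: take_Suc_conv_app_nth)
  have "machine \<theta> (known_load (future_loads rs ?s) ?pre) ?pre i =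
      machine \<theta> (\<lambda>t. real (load rs t)) rs i"
  proof (rule machine_cong)
    fix j d
    assume j: "j \<le> i" and d: "start (?pre ! j) \<le> d" "d < finish (?pre ! j)"
    show "known_load (future_loads rs ?s) ?pre d = real (load rs d)"
    proof (cases "d < ?s")
      case True
      then show ?thesis
        using load_take_eq[OF assms True] by (simp add: known_load_def last)
    next
      case False
      \<comment> \<open>Request \<open>j\<close> starts no later than \<open>i\<close>, so it ends
        within \<open>max_duration\<close> of the start of \<open>i\<close>: the load at
        \<open>d\<close> is among the announced ones.\<close>
      have "d - ?s < duration (rs ! j)"
        using d j False assms instance_start_mono[OF assms(1) j assms(2)]
        by (simp add: duration_def)
      also have "\<dots> \<le> max_duration rs"
        using j assms by (intro duration_le_max_duration) simp
      finally show ?thesis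
        using False by (simp add: known_load_def last future_loads_def)
    qed
  qed simp
  then show ?thesis
    unfolding schedule_with_future_loads_def online_schedule_def future_load_alg_def len by simp
qed

lemma packing_instance:
  assumes "dbp_instance T rs"
  shows "interval_packing (length rs) (\<lambda>j. start (rs ! j)) (\<lambda>j. finish (rs ! j))
    (small_weight \<theta> rs) (\<lambda>t. real (load rs t))"
proof
  fix d
  have "(\<Sum>j<length rs. if start (rs ! j) \<le> d \<and> d < finish (rs ! j) then small_weight \<theta> rs j else 0)
      \<le> total_weight rs d"
    unfolding total_weight_eq using instance_request(4)[OF assms]
    by (intro sum_mono) (auto simp: active_def small_weight_def less_imp_le)
  also have "\<dots> \<le> real (load rs d)"
    by (rule total_weight_le_load)
  finally show "(\<Sum>j<length rs. if start (rs ! j) \<le> d \<and> d < finish (rs ! j)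
      then small_weight \<theta> rs j else 0) \<le> real (load rs d)" .
qed (use instance_start_mono[OF assms] instance_request[OF assms] in
    \<open>auto simp: small_weight_def less_imp_le\<close>)

text \<open>That one of \<open>B\<close> bins fits is assumed here, so that uniform and general
  sizes share the argument. A small request lies on a level below the load at each of its times,
  hence at most \<open>B * load\<close> machines; bigger requests are counted one by one.\<close>

lemma future_load_alg_correct:
  fixes \<theta> :: real and rs :: "request list"
  defines "lv \<equiv> small_level \<theta> (\<lambda>t. real (load rs t)) rs"
    and "bn \<equiv> small_bin \<theta> (\<lambda>t. real (load rs t)) rs"
  assumes inst: "dbp_instance T rs"
    and bins: "\<And>i. i < length rs \<Longrightarrow> \<exists>b<B. interval_packing.bin_load (\<lambda>j. start (rs ! j))
      (\<lambda>j. finish (rs ! j)) (small_weight \<theta> rs) (\<lambda>t. real (load rs t)) i b + small_weight \<theta> rs i \<le> 1"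
  shows "feasible rs (schedule_with_future_loads (future_load_alg \<theta>) rs)"
    and "card (schedule_with_future_loads (future_load_alg \<theta>) rs ` active_idx rs t) \<le>
      B * load rs t + card {i \<in> active_idx rs t. \<theta> < weight (rs ! i)}"
proof -
  define n where "n = length rs"
  define w where "w = small_weight \<theta> rs"
  define U where "U = (\<lambda>t. real (load rs t))"
  define M where "M = machine \<theta> U rs"
  interpret interval_packing n "\<lambda>j. start (rs ! j)" "\<lambda>j. finish (rs ! j)" w U
    unfolding n_def w_def U_def by (rule packing_instance[OF inst])
  have lv: "lv = level U a w" and bn: "bn = bin lv (\<lambda>j. start (rs ! j)) a w"
    unfolding lv_def bn_def small_bin_def small_level_def U_def w_def by (rule refl)+
  have fits: "bn i < B" "bin_load i (bn i) + w i \<le> 1" if "i < n" for i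
    unfolding bn lv using bin_fits[of i B] bins that by (auto simp: n_def w_def U_def)
  have M: "M i = (if weight (rs ! i) \<le> \<theta> then Inl (lv i, bn i) else Inr i)" for i
    by (simp add: M_def machine_def lv_def bn_def U_def)
  have sched: "schedule_with_future_loads (future_load_alg \<theta>) rs i = to_nat (M i)"
    if "i < n" for i
    using future_load_schedule[OF inst, of i \<theta>] that by (simp add: n_def M_def U_def)
  have cap: "(\<Sum>j<n. if active (rs ! j) t \<and> M j = m then weight (rs ! j) else 0) \<le> 1" for t m
  proof (cases m)
    case (Inl lb)
    then obtain l b where m: "m = Inl (l, b)"
      by (cases lb) auto
    have "(\<Sum>j<n. if active (rs ! j) t \<and> M j = m then weight (rs ! j) else 0) \<le>
        (\<Sum>j<n. if a j t \<and> lv j = l \<and> bn j = b then w j else 0)"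
      using nonneg by (intro sum_mono) (auto simp: m M w_def small_weight_def active_def)
    also have "\<dots> \<le> 1"
      using machine_capacity[of t l b] fits(2) unfolding lv bn by blast
    finally show ?thesis .
  next
    case (Inr k)
    have "(\<Sum>j<n. if active (rs ! j) t \<and> M j = m then weight (rs ! j) else 0) \<le>
        (\<Sum>j<n. if j = k then weight (rs ! j) else 0)"
      using instance_request(4)[OF inst]
      by (intro sum_mono) (auto simp: Inr M n_def less_imp_le)
    also have "\<dots> \<le> 1"
      using instance_request(5)[OF inst] by (auto simp: sum.delta' n_def)
    finally show ?thesis .
  qed
  show "feasible rs (schedule_with_future_loads (future_load_alg \<theta>) rs)"
  proof (rule feasible_to_natI)
    show "0 < weight (rs ! i)" if "i < length rs" for i
      using instance_request(4)[OF inst that] .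
  qed (use sched cap in \<open>auto simp: n_def\<close>)
  let ?big = "{i \<in> active_idx rs t. \<theta> < weight (rs ! i)}"
  let ?L = "Inl ` ({..<load rs t} \<times> {..<B}) :: ((nat \<times> nat) + nat) set"
  let ?R = "Inr ` ?big :: ((nat \<times> nat) + nat) set"
  have "card (schedule_with_future_loads (future_load_alg \<theta>) rs ` active_idx rs t) =
      card (M ` active_idx rs t)"
    using sched by (intro card_to_nat_machines) (simp add: n_def)
  also have "\<dots> \<le> card (?L \<union> ?R)"
  proof (rule card_mono)
    show "M ` active_idx rs t \<subseteq> ?L \<union> ?R"
    proof
      fix m assume "m \<in> M ` active_idx rs t"
      then obtain i where i: "i < n" "a i t" "i \<in> active_idx rs t" "m = M i"
        by (auto simp: active_idx_def n_def active_def)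
      show "m \<in> ?L \<union> ?R"
      proof (cases "weight (rs ! i) \<le> \<theta>")
        case True
        then have "0 < w i"
          using instance_request(4)[OF inst] i(1) by (simp add: w_def small_weight_def n_def)
        then have "lv i < load rs t"
          using level_less[of i t] i unfolding lv U_def by simp
        then show ?thesis
          using True fits(1)[OF i(1)] i(4) by (auto simp: M)
      next
        case False
        then show ?thesis
          using i by (auto simp: M)
      qed
    qed
  qed simp
  also have "\<dots> \<le> card ?L + card ?R"
    by (rule card_Un_le)
  also have "\<dots> = B * load rs t + card ?big"
    by (simp add: card_image card_cartesian_product)
  finally show "card (schedule_with_future_loads (future_load_alg \<theta>) rs ` active_idx rs t) \<le>
      B * load rs t + card ?big" .
qed

lemma future_loads_uniform:
  assumes "dbp_instance T rs" and "uniform_size rs"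
  shows "feasible rs (schedule_with_future_loads (future_load_alg 1) rs)"
    and "avg_cost T rs (schedule_with_future_loads (future_load_alg 1) rs) \<le> 2 * OPT_avg T rs"
proof -
  obtain g :: nat where g: "1 \<le> g" "\<And>i. i < length rs \<Longrightarrow> weight (rs ! i) = 1 / real g"
    using assms(2) unfolding uniform_size_def by force
  have bins: "\<exists>b<2. interval_packing.bin_load (\<lambda>j. start (rs ! j)) (\<lambda>j. finish (rs ! j))
      (small_weight 1 rs) (\<lambda>t. real (load rs t)) i b + small_weight 1 rs i \<le> 1"
    if "i < length rs" for i
    using interval_packing.bin_exists_uniform[OF packing_instance[OF assms(1), of 1] g(1) _ that]
      g(2) instance_request(5)[OF assms(1)] by (simp add: small_weight_def)
  show "feasible rs (schedule_with_future_loads (future_load_alg 1) rs)"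
    by (rule future_load_alg_correct(1)[OF assms(1) bins])
  have "{i \<in> active_idx rs t. 1 < weight (rs ! i)} = {}" for t
    using instance_request(5)[OF assms(1)] by (force simp: active_idx_def)
  then have "card (schedule_with_future_loads (future_load_alg 1) rs ` active_idx rs t) \<le>
      2 * load rs t" for t
    using future_load_alg_correct(2)[OF assms(1) bins, of t] by (metis add_0_right card.empty)
  then show "avg_cost T rs (schedule_with_future_loads (future_load_alg 1) rs) \<le> 2 * OPT_avg T rs"
    using avg_cost_le_if_le_load[OF assms(1), of "schedule_with_future_loads (future_load_alg 1) rs" 2]
    by simp
qed

lemma future_loads_nonuniform:
  assumes "dbp_instance T rs"
  shows "feasible rs (schedule_with_future_loads (future_load_alg (1 / 2)) rs)"
    and "avg_cost T rs (schedule_with_future_loads (future_load_alg (1 / 2)) rs) \<le> 8 * OPT_avg T rs"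
proof -
  have bins: "\<exists>b<5. interval_packing.bin_load (\<lambda>j. start (rs ! j)) (\<lambda>j. finish (rs ! j))
      (small_weight (1 / 2) rs) (\<lambda>t. real (load rs t)) i b + small_weight (1 / 2) rs i \<le> 1"
    if "i < length rs" for i
    using interval_packing.bin_exists_small[OF packing_instance[OF assms(1), of "1 / 2"] _ that]
    by (simp add: small_weight_def)
  show "feasible rs (schedule_with_future_loads (future_load_alg (1 / 2)) rs)"
    by (rule future_load_alg_correct(1)[OF assms(1) bins])
  have big: "card {i \<in> active_idx rs t. 1 / 2 < weight (rs ! i)} \<le> 2 * load rs t" for t
  proof -
    let ?big = "{i \<in> active_idx rs t. 1 / 2 < weight (rs ! i)}"
    have "real (card ?big) * (1 / 2) = (\<Sum>i\<in>?big. 1 / 2)"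
      by simp
    also have "\<dots> \<le> (\<Sum>i\<in>?big. weight (rs ! i))"
      by (intro sum_mono) auto
    also have "\<dots> \<le> total_weight rs t"
      unfolding total_weight_def using instance_request(4)[OF assms]
      by (intro sum_mono2) (auto simp: active_idx_def less_imp_le)
    also have "\<dots> \<le> real (load rs t)"
      by (rule total_weight_le_load)
    finally show ?thesis
      by linarith
  qed
  \<comment> \<open>Five bins per level and at most two big requests per unit of load give 7 times
    the load, within the factor 8.\<close>
  have "card (schedule_with_future_loads (future_load_alg (1 / 2)) rs ` active_idx rs t) \<le>
      8 * load rs t" for t
    using future_load_alg_correct(2)[OF assms(1) bins, of t] big[of t] by linarith
  then show "avg_cost T rs (schedule_with_future_loads (future_load_alg (1 / 2)) rs) \<le> 8 * OPT_avg T rs"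
    using avg_cost_le_if_le_load[OF assms(1),
        of "schedule_with_future_loads (future_load_alg (1 / 2)) rs" 8] by simp
qed

section \<open>Next-Fit and Harmonic\<close>

fun end_level :: "real \<Rightarrow> real list \<Rightarrow> real" where
  "end_level a [] = a"
| "end_level a (x # xs) = (if a + x \<le> 1 then end_level (a + x) xs else end_level x xs)"

lemma next_fit_from_append:
  "next_fit_from a (xs @ ys) = next_fit_from a xs + next_fit_from (end_level a xs) ys"
  by (induction xs arbitrary: a) auto

lemma end_level_append: "end_level a (xs @ ys) = end_level (end_level a xs) ys"
  by (induction xs arbitrary: a) auto

text \<open>A full bin, into which no item of positive size fits, stands for no bin at all.\<close>

lemma next_fit_eq_from_1:
  assumes "set xs \<subseteq> {0<..}"
  shows "next_fit xs = next_fit_from 1 xs"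
  using assms by (cases xs) auto

lemma end_level_bounds:
  assumes "set xs \<subseteq> {0..1}" and "0 \<le> a" "a \<le> 1"
  shows "0 \<le> end_level a xs" "end_level a xs \<le> 1"
  using assms by (induction xs arbitrary: a) auto

text \<open>Suppose the fuller bin \<open>b\<close> rejects \<open>x\<close> while \<open>a\<close>
  accepts it. The first run is now one bin ahead, but its new bin holds only \<open>x\<close>
  against \<open>a + x\<close>: the roles are exchanged, so the lead never exceeds one.\<close>

lemma next_fit_from_mono:
  assumes "set xs \<subseteq> {0..}" and "a \<le> b" and "0 \<le> a"
  shows "next_fit_from a xs \<le> next_fit_from b xs \<and> next_fit_from b xs \<le> Suc (next_fit_from a xs)"
  using assms
proof (induction xs arbitrary: a b)
  case (Cons x xs)
  have x: "0 \<le> x" and xs: "set xs \<subseteq> {0..}"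
    using Cons.prems by auto
  consider "b + x \<le> 1" | "1 < a + x" | "a + x \<le> 1" "1 < b + x"
    by linarith
  then show ?case
  proof cases
    case 1
    then show ?thesis
      using Cons.IH[OF xs, of "a + x" "b + x"] Cons.prems x by simp
  next
    case 2
    then show ?thesis
      using Cons.prems by simp
  next
    case 3
    then show ?thesis
      using Cons.IH[OF xs, of x "a + x"] Cons.prems x by auto
  qed
qed simp

text \<open>Every item is charged twice. When a bin is closed, its level and the rejected item
  exceed 1 and pay for the new bin; the second charge of the item serves as the new level.\<close>

lemma next_fit_from_le_volume:
  assumes "set xs \<subseteq> {0..}" and "0 \<le> a"
  shows "real (next_fit_from a xs) \<le> a + 2 * sum_list xs"
  using assms
proof (induction xs arbitrary: a)
  case (Cons x xs)
  have x: "0 \<le> x" and xs: "set xs \<subseteq> {0..}"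
    using Cons.prems by auto
  show ?case
  proof (cases "a + x \<le> 1")
    case True
    then show ?thesis
      using Cons.IH[OF xs, of "a + x"] Cons.prems x by auto
  next
    case False
    then show ?thesis
      using Cons.IH[OF xs, of x] x by auto
  qed
qed auto

lemma next_fit_le_volume:
  assumes "set xs \<subseteq> {0<..}"
  shows "real (next_fit xs) \<le> 1 + 2 * sum_list xs"
proof -
  have "set xs \<subseteq> {0..}"
    using assms by auto
  then show ?thesis
    using next_fit_from_le_volume[of xs 1] by (simp add: next_fit_eq_from_1[OF assms])
qed

text \<open>Levels are multiples \<open>p / g\<close>, so a bin is closed only at level exactly 1
  and nothing is wasted. The invariant \<open>0 < p\<close> makes the inequality strict, which later
  bounds the number of bins by the rounded-up load.\<close>

lemma next_fit_from_uniform: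
  assumes "1 \<le> g" and "set xs \<subseteq> {1 / real g}" and "0 < p" "p \<le> g"
  shows "real (next_fit_from (real p / real g) xs) < real p / real g + sum_list xs"
  using assms(2-)
proof (induction xs arbitrary: p)
  case Nil
  then show ?case
    using assms(1) by simp
next
  case (Cons x xs)
  have x: "x = 1 / real g" and xs: "set xs \<subseteq> {1 / real g}"
    using Cons.prems by auto
  show ?case
  proof (cases "p + 1 \<le> g")
    case True
    then have "real p / real g + x \<le> 1"
      using assms(1) by (simp add: x field_simps)
    moreover have "real p / real g + x = real (p + 1) / real g"
      by (simp add: x add_divide_distrib)
    ultimately show ?thesis
      using Cons.IH[OF xs, of "p + 1"] True x by simp
  next
    case False
    then have "p = g"
      using Cons.prems by simp
    then have "real p / real g = 1"
      using assms(1) by simp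
    then show ?thesis
      using Cons.IH[OF xs, of 1] assms(1) x by simp
  qed
qed

lemma next_fit_uniform:
  assumes "1 \<le> g" and "set xs \<subseteq> {1 / real g}"
  shows "real (next_fit xs) < 1 + sum_list xs"
proof -
  have "next_fit xs = next_fit_from 1 xs"
    using assms by (intro next_fit_eq_from_1) auto
  then show ?thesis
    using next_fit_from_uniform[OF assms, of g] assms(1) by simp
qed

text \<open>Alone, \<open>ys\<close> starts from a full bin; in the concatenation it starts from the
  level left by \<open>xs\<close>. By monotonicity this differs by at most one bin.\<close>

lemma next_fit_append_ge:
  assumes "set xs \<subseteq> {0<..1}" and "set ys \<subseteq> {0<..1}"
  shows "next_fit xs + next_fit ys \<le> Suc (next_fit (xs @ ys))"
proof -
  have "0 \<le> end_level 1 xs" "end_level 1 xs \<le> 1"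
    using assms(1) by (intro end_level_bounds; force)+
  then have "next_fit_from 1 ys \<le> Suc (next_fit_from (end_level 1 xs) ys)"
    using assms(2) by (intro next_fit_from_mono[THEN conjunct2]) auto
  then show ?thesis
    using assms by (subst (1 2 3) next_fit_eq_from_1) (auto simp: next_fit_from_append)
qed

text \<open>This serves to merge separately packed groups into a single input for Harmonic, at one
  extra bin per nonempty group.\<close>

lemma next_fit_concat_ge:
  assumes "\<And>x. x \<in> set ks \<Longrightarrow> set (L x) \<subseteq> {0<..1}"
  shows "(\<Sum>x\<leftarrow>ks. next_fit (L x)) \<le>
    next_fit (concat (map L ks)) + length (filter (\<lambda>x. L x \<noteq> []) ks)"
  using assms
proof (induction ks)
  case (Cons k ks)
  have "next_fit (L k) + next_fit (concat (map L ks)) \<le> Suc (next_fit (L k @ concat (map L ks)))"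
    using Cons.prems by (intro next_fit_append_ge) auto
  then show ?case
    using Cons by (cases "L k = []") auto
qed simp

lemma next_fit_append_mono: "next_fit_from a xs \<le> next_fit_from a (xs @ ys)"
  by (simp add: next_fit_from_append)

section \<open>Harmonic through size classes\<close>

definition size_class :: "nat \<Rightarrow> real \<Rightarrow> nat" where
  "size_class k x = (if x \<le> 1 / real k then k else nat \<lfloor>1 / x\<rfloor>)"

lemma size_class_eq_iff:
  assumes "0 < x" and "1 \<le> j" and "j < k"
  shows "size_class k x = j \<longleftrightarrow> 1 / real (j + 1) < x \<and> x \<le> 1 / real j"
proof -
  have j: "nat \<lfloor>1 / x\<rfloor> = j \<longleftrightarrow> 1 / real (j + 1) < x \<and> x \<le> 1 / real j"
  proof -
    have "0 \<le> \<lfloor>1 / x\<rfloor>"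
      using assms(1) by simp
    then have "nat \<lfloor>1 / x\<rfloor> = j \<longleftrightarrow> \<lfloor>1 / x\<rfloor> = int j"
      by linarith
    also have "\<dots> \<longleftrightarrow> real j \<le> 1 / x \<and> 1 / x < real j + 1"
      by (simp add: floor_eq_iff)
    also have "\<dots> \<longleftrightarrow> 1 / real (j + 1) < x \<and> x \<le> 1 / real j"
      using assms by (auto simp: field_simps)
    finally show ?thesis .
  qed
  show ?thesis
  proof (cases "x \<le> 1 / real k")
    case True
    moreover have "1 / real k \<le> 1 / real (j + 1)"
      using assms by (intro divide_left_mono) auto
    ultimately show ?thesis
      using assms by (auto simp: size_class_def)
  qed (use j in \<open>simp add: size_class_def\<close>)
qed

lemma size_class_range:
  assumes "0 < x" "x \<le> 1" and "1 \<le> k"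
  shows "size_class k x \<in> {1..k}"
proof (cases "x \<le> 1 / real k")
  case False
  then have "1 / x < real k" "1 \<le> 1 / x"
    using assms by (auto simp: field_simps)
  then have "1 \<le> nat \<lfloor>1 / x\<rfloor>" "nat \<lfloor>1 / x\<rfloor> \<le> k"
    by linarith+
  then show ?thesis
    using False by (simp add: size_class_def)
qed (use assms in \<open>simp add: size_class_def\<close>)

lemma size_class_last:
  assumes "0 < x" "1 \<le> k"
  shows "size_class k x = k \<longleftrightarrow> x \<le> 1 / real k"
proof (cases "x \<le> 1 / real k")
  case False
  then have "1 / x < real k"
    using assms by (auto simp: field_simps)
  then have "nat \<lfloor>1 / x\<rfloor> < k"
    using assms by linarith
  then show ?thesis
    using False by (simp add: size_class_def)
qed (simp add: size_class_def)

lemma harmonic_eq: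
  assumes "1 \<le> k" and "set xs \<subseteq> {0<..1}"
  shows "harmonic k xs = (\<Sum>j=1..k. next_fit (filter (\<lambda>x. size_class k x = j) xs))"
proof -
  have "(\<Sum>j=1..k. next_fit (filter (\<lambda>x. size_class k x = j) xs)) =
      (\<Sum>j\<in>{1..<k}. next_fit (filter (\<lambda>x. size_class k x = j) xs)) +
      next_fit (filter (\<lambda>x. size_class k x = k) xs)"
    using assms(1) by (simp add: sum.last_plus add.commute)
  also have "filter (\<lambda>x. size_class k x = k) xs = filter (\<lambda>x. x \<le> 1 / real k) xs"
    using assms size_class_last by (intro filter_cong) auto
  also have "(\<Sum>j\<in>{1..<k}. next_fit (filter (\<lambda>x. size_class k x = j) xs)) =
      (\<Sum>j\<in>{1..<k}. next_fit (filter (\<lambda>x. 1 / real (j + 1) < x \<and> x \<le> 1 / real j) xs))"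
  proof (rule sum.cong[OF refl])
    fix j assume "j \<in> {1..<k}"
    then have "filter (\<lambda>x. size_class k x = j) xs =
        filter (\<lambda>x. 1 / real (j + 1) < x \<and> x \<le> 1 / real j) xs"
      using assms(2) by (intro filter_cong refl size_class_eq_iff) auto
    then show "next_fit (filter (\<lambda>x. size_class k x = j) xs) =
        next_fit (filter (\<lambda>x. 1 / real (j + 1) < x \<and> x \<le> 1 / real j) xs)"
      by simp
  qed
  finally show ?thesis
    by (simp add: harmonic_def)
qed

lemma sum_filter_class:
  assumes "finite J" and "\<And>x. x \<in> set xs \<Longrightarrow> f x \<in> J"
  shows "(\<Sum>j\<in>J. sum_list (filter (\<lambda>x. f x = j) xs)) = (sum_list xs :: real)"
  using assms(2)
proof (induction xs)
  case (Cons x xs)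
  have "(\<Sum>j\<in>J. sum_list (filter (\<lambda>x. f x = j) (x # xs))) =
      (\<Sum>j\<in>J. (if f x = j then x else 0) + sum_list (filter (\<lambda>x. f x = j) xs))"
    by (intro sum.cong) auto
  also have "\<dots> = x + sum_list xs"
    using Cons assms(1) by (simp add: sum.distrib sum.delta')
  finally show ?case
    by simp
qed simp

section \<open>Static packings and the asymptotic ratio of Harmonic\<close>

definition packable :: "real list \<Rightarrow> nat \<Rightarrow> bool" where
  "packable xs m \<longleftrightarrow> (\<exists>f :: nat \<Rightarrow> nat. (\<forall>i<length xs. f i < m) \<and>
     (\<forall>b<m. (\<Sum>i\<in>{i. i < length xs \<and> f i = b}. xs ! i) \<le> 1))"

lemma opt_bins_eq: "opt_bins xs = (LEAST m. packable xs m)"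
  by (simp add: opt_bins_def packable_def)

lemma opt_bins_le: "packable xs m \<Longrightarrow> opt_bins xs \<le> m"
  unfolding opt_bins_eq by (rule Least_le)

lemma packable_opt_bins:
  assumes "set xs \<subseteq> {0<..1}"
  shows "packable xs (opt_bins xs)"
proof -
  have "packable xs (length xs)"
    unfolding packable_def
  proof (intro exI[of _ "\<lambda>i. i"] conjI allI impI)
    fix b assume b: "b < length xs"
    then have "{i. i < length xs \<and> i = b} = {b}"
      by auto
    then show "(\<Sum>i\<in>{i. i < length xs \<and> i = b}. xs ! i) \<le> 1"
      using assms nth_mem[OF b] by auto
  qed
  then show ?thesis
    unfolding opt_bins_eq by (rule LeastI)
qed

lemma sum_list_le_opt_bins:
  assumes "set xs \<subseteq> {0<..1}"
  shows "sum_list xs \<le> real (opt_bins xs)"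
proof -
  obtain f where f: "\<forall>i<length xs. f i < opt_bins xs"
      "\<forall>b<opt_bins xs. (\<Sum>i\<in>{i. i < length xs \<and> f i = b}. xs ! i) \<le> 1"
    using packable_opt_bins[OF assms] unfolding packable_def by blast
  have "sum_list xs = (\<Sum>i<length xs. xs ! i)"
    by (simp add: sum_list_sum_nth atLeast0LessThan)
  also have "\<dots> = (\<Sum>b<opt_bins xs. \<Sum>i\<in>{i \<in> {..<length xs}. f i = b}. xs ! i)"
    using f(1) by (intro sum.group[symmetric]) auto
  also have "\<dots> \<le> (\<Sum>b<opt_bins xs. 1)"
    using f(2) by (intro sum_mono) auto
  finally show ?thesis
    by simp
qed

lemma packable_append:
  assumes "packable xs m" and "packable ys n"
  shows "packable (xs @ ys) (m + n)"
proof -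
  obtain f where f: "\<forall>i<length xs. f i < m"
      "\<forall>b<m. (\<Sum>i\<in>{i. i < length xs \<and> f i = b}. xs ! i) \<le> 1"
    using assms(1) unfolding packable_def by blast
  obtain g where g: "\<forall>i<length ys. g i < n"
      "\<forall>b<n. (\<Sum>i\<in>{i. i < length ys \<and> g i = b}. ys ! i) \<le> 1"
    using assms(2) unfolding packable_def by blast
  define h where "h i = (if i < length xs then f i else m + g (i - length xs))" for i
  show ?thesis
    unfolding packable_def
  proof (intro exI[of _ h] conjI allI impI)
    show "h i < m + n" if "i < length (xs @ ys)" for i
      using that f(1) g(1) by (auto simp: h_def trans_less_add1)
  next
    fix b assume b: "b < m + n"
    show "(\<Sum>i\<in>{i. i < length (xs @ ys) \<and> h i = b}. (xs @ ys) ! i) \<le> 1"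
    proof (cases "b < m")
      case True
      then have "{i. i < length (xs @ ys) \<and> h i = b} = {i. i < length xs \<and> f i = b}"
        by (auto simp: h_def)
      moreover have "(\<Sum>i\<in>{i. i < length xs \<and> f i = b}. (xs @ ys) ! i) =
          (\<Sum>i\<in>{i. i < length xs \<and> f i = b}. xs ! i)"
        by (intro sum.cong) (auto simp: nth_append)
      ultimately show ?thesis
        using f(2) True by simp
    next
      case False
      have "{i. i < length (xs @ ys) \<and> h i = b} =
          (\<lambda>i. i + length xs) ` {i. i < length ys \<and> g i = b - m}"
      proof (intro set_eqI iffI)
        fix i assume "i \<in> {i. i < length (xs @ ys) \<and> h i = b}"
        then show "i \<in> (\<lambda>i. i + length xs) ` {i. i < length ys \<and> g i = b - m}"
          using False f(1)
          by (intro image_eqI[of _ _ "i - length xs"]) (auto simp: h_def split: if_splits)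
      qed (use False in \<open>auto simp: h_def\<close>)
      moreover have "(\<Sum>i\<in>(\<lambda>i. i + length xs) ` {i. i < length ys \<and> g i = b - m}. (xs @ ys) ! i) =
          (\<Sum>i\<in>{i. i < length ys \<and> g i = b - m}. ys ! i)"
        by (subst sum.reindex) (auto simp: nth_append)
      ultimately show ?thesis
        using g(2) b False by simp
    qed
  qed
qed

lemma opt_bins_append:
  assumes "set xs \<subseteq> {0<..1}" and "set ys \<subseteq> {0<..1}"
  shows "opt_bins (xs @ ys) \<le> opt_bins xs + opt_bins ys"
  using assms by (intro opt_bins_le packable_append packable_opt_bins)

lemma opt_bins_replicate:
  assumes "set xs \<subseteq> {0<..1}"
  shows "opt_bins (concat (replicate N xs)) \<le> N * opt_bins xs"
proof (induction N)
  case 0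
  have "packable [] 0"
    by (simp add: packable_def)
  then show ?case
    using opt_bins_le by fastforce
next
  case (Suc N)
  have "opt_bins (xs @ concat (replicate N xs)) \<le> opt_bins xs + opt_bins (concat (replicate N xs))"
    using assms by (intro opt_bins_append) auto
  then show ?case
    using Suc by simp
qed

text \<open>The crude ratio 2 shows that the set whose infimum is \<open>harmonic_ratio\<close> is
  nonempty; it also settles inputs whose optimum is 0.\<close>

lemma harmonic_le_volume:
  assumes "1 \<le> k" and "set xs \<subseteq> {0<..1}"
  shows "real (harmonic k xs) \<le> 2 * real (opt_bins xs) + real k"
proof -
  have "real (harmonic k xs) \<le>
      (\<Sum>j=1..k. 1 + 2 * sum_list (filter (\<lambda>x. size_class k x = j) xs))"
    unfolding harmonic_eq[OF assms] of_nat_sum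
    using assms(2) by (intro sum_mono next_fit_le_volume) auto
  also have "\<dots> = real k + 2 * (\<Sum>j=1..k. sum_list (filter (\<lambda>x. size_class k x = j) xs))"
    by (simp add: sum.distrib sum_distrib_left)
  also have "(\<Sum>j=1..k. sum_list (filter (\<lambda>x. size_class k x = j) xs)) = sum_list xs"
    using assms size_class_range by (intro sum_filter_class) auto
  also have "\<dots> \<le> real (opt_bins xs)"
    by (rule sum_list_le_opt_bins) fact
  finally show ?thesis
    by simp
qed

text \<open>Concatenation lets neighbouring copies share a bin, which saves at most one bin per copy
  in each of the \<open>k\<close> classes.\<close>

lemma harmonic_replicate:
  assumes "1 \<le> k" and "set xs \<subseteq> {0<..1}"
  shows "N * harmonic k xs \<le> harmonic k (concat (replicate N xs)) + N * k"
proof -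
  have "N * harmonic k xs =
      (\<Sum>j=1..k. \<Sum>x\<leftarrow>replicate N (). next_fit (filter (\<lambda>x. size_class k x = j) xs))"
    unfolding harmonic_eq[OF assms] by (simp add: sum_list_replicate sum_distrib_left)
  also have "\<dots> \<le> (\<Sum>j=1..k. next_fit (concat (map (\<lambda>_. filter (\<lambda>x. size_class k x = j) xs)
      (replicate N ()))) + length (replicate N ()))"
  proof (rule sum_mono)
    fix j
    let ?L = "\<lambda>_::unit. filter (\<lambda>x. size_class k x = j) xs"
    have "(\<Sum>x\<leftarrow>replicate N (). next_fit (?L x)) \<le> next_fit (concat (map ?L (replicate N ()))) +
        length (filter (\<lambda>x. ?L x \<noteq> []) (replicate N ()))"
      using assms(2) by (intro next_fit_concat_ge) auto
    also have "length (filter (\<lambda>x. ?L x \<noteq> []) (replicate N ())) \<le> length (replicate N ())"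
      by (rule length_filter_le)
    finally show "(\<Sum>x\<leftarrow>replicate N (). next_fit (?L x)) \<le>
        next_fit (concat (map ?L (replicate N ()))) + length (replicate N ())"
      by simp
  qed
  also have "\<dots> = harmonic k (concat (replicate N xs)) + N * k"
  proof -
    have "set (concat (replicate N xs)) \<subseteq> {0<..1}"
      using assms(2) by auto
    then show ?thesis
      using assms(1) by (simp add: harmonic_eq sum.distrib filter_concat)
  qed
  finally show ?thesis .
qed

text \<open>On \<open>N\<close> items of size 1 the optimum is at least \<open>N\<close>, so a
  negative ratio would bound a number of bins by a negative value once \<open>N\<close> is
  large.\<close>

lemma ratio_bound_nonneg:
  assumes c: "\<And>xs. set xs \<subseteq> {0<..1} \<Longrightarrow> real (harmonic k xs) \<le> \<rho> * real (opt_bins xs) + c"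
  shows "0 \<le> \<rho>"
proof (rule ccontr)
  assume "\<not> 0 \<le> \<rho>"
  obtain N :: nat where N: "c / - \<rho> < real N"
    using reals_Archimedean2 by blast
  have "sum_list (replicate N 1) \<le> real (opt_bins (replicate N 1))"
    by (intro sum_list_le_opt_bins) auto
  then have "real N \<le> real (opt_bins (replicate N 1))"
    by (simp add: sum_list_replicate)
  then have "\<rho> * real (opt_bins (replicate N 1)) + c \<le> \<rho> * real N + c"
    using \<open>\<not> 0 \<le> \<rho>\<close> by (intro add_right_mono mult_left_mono_neg) auto
  also have "\<dots> < 0"
    using N \<open>\<not> 0 \<le> \<rho>\<close> by (simp add: field_simps)
  finally show False
    using c[of "replicate N 1"] by fastforce
qed

lemma harmonic_ratio_nonneg:
  assumes "1 \<le> k"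
  shows "0 \<le> harmonic_ratio k"
  unfolding harmonic_ratio_def
proof (rule cInf_greatest)
  show "{\<rho>. \<exists>c. \<forall>xs. set xs \<subseteq> {0<..1} \<longrightarrow>
     real (harmonic k xs) \<le> \<rho> * real (opt_bins xs) + c} \<noteq> {}"
    using harmonic_le_volume[OF assms] by blast
next
  fix \<rho>
  assume "\<rho> \<in> {\<rho>. \<exists>c. \<forall>xs. set xs \<subseteq> {0<..1} \<longrightarrow>
     real (harmonic k xs) \<le> \<rho> * real (opt_bins xs) + c}"
  then obtain c where "\<forall>xs. set xs \<subseteq> {0<..1} \<longrightarrow> real (harmonic k xs) \<le> \<rho> * real (opt_bins xs) + c"
    by blast
  then show "0 \<le> \<rho>"
    by (intro ratio_bound_nonneg[of k \<rho> c]) blast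
qed

text \<open>Repeating the input \<open>N\<close> times multiplies both sides by \<open>N\<close>, up
  to \<open>k\<close> bins per copy, while \<open>c\<close> stays fixed. So the excess
  \<open>d\<close> satisfies \<open>N * d \<le> c\<close> for all \<open>N\<close>, hence
  \<open>d \<le> 0\<close>. This holds for every admissible \<open>\<rho>\<close> and therefore for
  the infimum.\<close>

lemma harmonic_le_ratio:
  assumes "1 \<le> k" and "set xs \<subseteq> {0<..1}"
  shows "real (harmonic k xs) \<le> harmonic_ratio k * real (opt_bins xs) + real k"
proof (cases "opt_bins xs = 0")
  case True
  then show ?thesis
    using harmonic_le_volume[OF assms] by simp
next
  case False
  let ?R = "{\<rho>. \<exists>c. \<forall>xs. set xs \<subseteq> {0<..1} \<longrightarrow>
     real (harmonic k xs) \<le> \<rho> * real (opt_bins xs) + c}"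
  have "(real (harmonic k xs) - real k) / real (opt_bins xs) \<le> Inf ?R"
  proof (rule cInf_greatest)
    show "?R \<noteq> {}"
      using harmonic_le_volume[OF assms(1)] by blast
  next
    fix \<rho> assume "\<rho> \<in> ?R"
    then obtain c where c: "\<And>xs. set xs \<subseteq> {0<..1} \<Longrightarrow>
        real (harmonic k xs) \<le> \<rho> * real (opt_bins xs) + c"
      by blast
    define d where "d = real (harmonic k xs) - real k - \<rho> * real (opt_bins xs)"
    have "0 \<le> \<rho>"
      using c by (rule ratio_bound_nonneg)
    have "real N * d \<le> c" for N
    proof -
      have "real N * real (harmonic k xs) \<le> real (harmonic k (concat (replicate N xs))) + real N * real k"
        using harmonic_replicate[OF assms, of N] by (metis of_nat_add of_nat_le_iff of_nat_mult)
      also have "real (harmonic k (concat (replicate N xs))) \<le>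
          \<rho> * real (opt_bins (concat (replicate N xs))) + c"
        using assms(2) by (intro c) auto
      also have "\<rho> * real (opt_bins (concat (replicate N xs))) \<le> \<rho> * (real N * real (opt_bins xs))"
        using opt_bins_replicate[OF assms(2), of N] \<open>0 \<le> \<rho>\<close>
        by (intro mult_left_mono) (metis of_nat_le_iff of_nat_mult, simp)
      finally show ?thesis
        by (simp add: d_def algebra_simps)
    qed
    then have "d \<le> 0"
      by (metis less_eq_real_def linorder_not_less reals_Archimedean3)
    then show "(real (harmonic k xs) - real k) / real (opt_bins xs) \<le> \<rho>"
      using False by (simp add: d_def field_simps)
  qed
  then show ?thesis
    using False by (simp add: harmonic_ratio_def field_simps)
qed

section \<open>The algorithm for the average load\<close>

definition length_class :: "request \<Rightarrow> nat" where
  "length_class r = floor_log (duration r)"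

text \<open>Rounding down after the lower cap 1 keeps the width positive, and
  \<open>width - 1\<close> at most the uncapped product; \<open>departing_volume\<close> needs the
  latter.\<close>

definition width :: "real \<Rightarrow> nat \<Rightarrow> nat" where
  "width v i = nat \<lfloor>max 1 (min 1 (sqrt (real (i + 1) / v)) * 2 ^ i)\<rfloor>"

definition type_of :: "real \<Rightarrow> request \<Rightarrow> nat \<times> nat" where
  "type_of v r = (length_class r, finish r div width v (length_class r))"

text \<open>In these classes \<open>sqrt ((i + 1) / v)\<close> exceeds 1, and the share is a fifth
  of its reciprocal. The 5 makes the shares on one pool machine add up to at most 1, see
  \<open>pool_shares_fit\<close>.\<close>

definition pool_share :: "real \<Rightarrow> nat \<Rightarrow> real" where
  "pool_share v i = (if v < real (i + 1) then sqrt (v / real (i + 1)) / 5 else 0)"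

text \<open>
  The first requests of each type, up to a total size of \<open>pool_share\<close>, go to
  machines shared by many types. Without this, a type of tiny load could occupy a machine of its own.
\<close>

function pooled :: "real \<Rightarrow> request list \<Rightarrow> nat \<Rightarrow> bool" where
  "pooled v rs i \<longleftrightarrow>
     (\<Sum>j<i. if pooled v rs j \<and> type_of v (rs ! j) = type_of v (rs ! i) then weight (rs ! j) else 0)
       + weight (rs ! i) \<le> pool_share v (length_class (rs ! i))"
  by pat_completeness auto
termination
  by (relation "measure (\<lambda>(_, _, i). i)") auto

declare pooled.simps [simp del]

text \<open>\<open>cls\<close> will be \<open>size_class k\<close> for general sizes and constant
  for uniform sizes, so that one analysis covers both.\<close>

definition key_of :: "real \<Rightarrow> (real \<Rightarrow> nat) \<Rightarrow> request \<Rightarrow> (nat \<times> nat) \<times> nat" where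
  "key_of v cls r = (type_of v r, cls (weight r))"

definition key_weights ::
    "real \<Rightarrow> (real \<Rightarrow> nat) \<Rightarrow> request list \<Rightarrow> (nat \<times> nat) \<times> nat \<Rightarrow> nat \<Rightarrow> real list" where
  "key_weights v cls rs \<kappa> m = map (\<lambda>j. weight (rs ! j))
     (filter (\<lambda>j. \<not> pooled v rs j \<and> key_of v cls (rs ! j) = \<kappa>) [0..<m])"

text \<open>Starting from a fictitious full bin, the number of bins opened up to and including
  request \<open>i\<close> is the index, counted from 1, of the bin that receives it. Departures are
  ignored.\<close>

definition next_fit_bin :: "real \<Rightarrow> (real \<Rightarrow> nat) \<Rightarrow> request list \<Rightarrow> nat \<Rightarrow> nat" where
  "next_fit_bin v cls rs i = next_fit_from 1 (key_weights v cls rs (key_of v cls (rs ! i)) (Suc i))"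

text \<open>At any time the active requests of a long class fall into three consecutive windows, so
  the residue modulo 3 separates types of equal class. The first component collects classes whose
  shares fit into one machine together.\<close>

definition pool_machine :: "real \<Rightarrow> request \<Rightarrow> nat \<times> nat" where
  "pool_machine v r =
     (nat \<lfloor>sqrt (v * real (length_class r + 1))\<rfloor>, snd (type_of v r) mod 3)"

definition class_machine ::
    "real \<Rightarrow> (real \<Rightarrow> nat) \<Rightarrow> request list \<Rightarrow> nat \<Rightarrow> (nat \<times> nat) + ((nat \<times> nat) \<times> nat) \<times> nat" where
  "class_machine v cls rs i =
     (if pooled v rs i then Inl (pool_machine v (rs ! i))
      else Inr (key_of v cls (rs ! i), next_fit_bin v cls rs i))"

definition avg_load_alg :: "(real \<Rightarrow> nat) \<Rightarrow> real online_alg" where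
  "avg_load_alg cls v rs = to_nat (class_machine v cls rs (length rs - 1))"

section \<open>Online computability and elementary estimates\<close>

lemma pooled_cong:
  assumes "\<And>j. j \<le> i \<Longrightarrow> rs ! j = rs' ! j"
  shows "pooled v rs i = pooled v rs' i"
  using assms
proof (induction i rule: less_induct)
  case (less i)
  have IH: "pooled v rs j = pooled v rs' j" if "j < i" for j
    using that less.prems by (intro less.IH) auto
  have "(\<Sum>j<i. if pooled v rs j \<and> type_of v (rs ! j) = type_of v (rs ! i) then weight (rs ! j) else 0) =
      (\<Sum>j<i. if pooled v rs' j \<and> type_of v (rs' ! j) = type_of v (rs' ! i) then weight (rs' ! j) else 0)"
    using IH less.prems by (intro sum.cong) auto
  then show ?case
    using less.prems[of i] by (subst (1 2) pooled.simps) simp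
qed

lemma class_machine_cong:
  assumes "\<And>j. j \<le> i \<Longrightarrow> rs ! j = rs' ! j"
  shows "class_machine v cls rs i = class_machine v cls rs' i"
proof -
  have p: "pooled v rs j = pooled v rs' j" if "j \<le> i" for j
    using that assms by (intro pooled_cong) auto
  have "key_weights v cls rs \<kappa> (Suc i) = key_weights v cls rs' \<kappa> (Suc i)" for \<kappa>
    unfolding key_weights_def
  proof (rule map_cong)
    show "filter (\<lambda>j. \<not> pooled v rs j \<and> key_of v cls (rs ! j) = \<kappa>) [0..<Suc i] =
        filter (\<lambda>j. \<not> pooled v rs' j \<and> key_of v cls (rs' ! j) = \<kappa>) [0..<Suc i]"
      using p assms by (intro filter_cong) auto
  qed (use assms in \<open>auto simp del: upt_Suc\<close>)
  then show ?thesis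
    using p[of i] assms[of i] by (simp add: class_machine_def next_fit_bin_def)
qed

lemma avg_load_schedule:
  assumes "i < length rs"
  shows "schedule_with_avg_load (avg_load_alg cls) T rs i =
    to_nat (class_machine (avg_load T rs) cls rs i)"
proof -
  have "length (take (Suc i) rs) - 1 = i"
    using assms by simp
  moreover have "class_machine v cls (take (Suc i) rs) i = class_machine v cls rs i" for v
    by (intro class_machine_cong) simp
  ultimately show ?thesis
    by (simp add: schedule_with_avg_load_def online_schedule_def avg_load_alg_def)
qed

lemma card_nat_interval_le:
  assumes "0 \<le> a" and "a \<le> b" and "S \<subseteq> {x::nat. a \<le> real x \<and> real x < b}"
  shows "finite S" and "real (card S) \<le> b - a + 1"
proof -
  have sub: "S \<subseteq> {nat \<lceil>a\<rceil>..<nat \<lceil>b\<rceil>}"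
  proof
    fix x assume "x \<in> S"
    then have "a \<le> real x" "real x < b"
      using assms(3) by auto
    then have "\<lceil>a\<rceil> \<le> int x" "int x < \<lceil>b\<rceil>"
      by linarith+
    then have "nat \<lceil>a\<rceil> \<le> x" "x < nat \<lceil>b\<rceil>"
      by linarith+
    then show "x \<in> {nat \<lceil>a\<rceil>..<nat \<lceil>b\<rceil>}"
      by simp
  qed
  then show "finite S"
    by (rule finite_subset) simp
  have "card S \<le> nat \<lceil>b\<rceil> - nat \<lceil>a\<rceil>"
    using card_mono[OF _ sub] by simp
  moreover have "\<lceil>a\<rceil> \<le> \<lceil>b\<rceil>" "0 \<le> \<lceil>a\<rceil>"
    using assms by (auto intro: ceiling_mono)
  ultimately show "real (card S) \<le> b - a + 1"
    by linarith
qed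

lemma sum_inverse_sqrt_le: "(\<Sum>i<n. 1 / sqrt (real (i + 1))) \<le> 2 * sqrt (real n)"
proof (induction n)
  case (Suc n)
  let ?a = "sqrt (real n)" and ?b = "sqrt (real n + 1)"
  have "?b > 0"
    by simp
  \<comment> \<open>Since \<open>?a * ?a + 1 = ?b * ?b\<close>, the square gives
    \<open>2 * ?a * ?b + 1 \<le> 2 * (?b * ?b)\<close>, which is the induction step after division
    by \<open>?b\<close>.\<close>
  have "0 \<le> (?a - ?b)\<^sup>2"
    by simp
  moreover have "?b * ?b = real n + 1"
    by simp
  ultimately have "2 * ?a * ?b + 1 \<le> 2 * (?b * ?b)"
    by (simp add: power2_diff)
  then have "2 * ?a + 1 / ?b \<le> 2 * ?b"
    using \<open>?b > 0\<close> by (simp add: field_simps)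
  then show ?case
    using Suc by (simp add: add.commute)
qed simp

lemma residue_close:
  fixes a x y :: nat
  assumes "a \<le> x" "x \<le> a + 2" "a \<le> y" "y \<le> a + 2" and "x mod 3 = y mod 3"
  shows "x = y"
proof -
  have "x = y" if "y \<le> x" "x \<le> y + 2" "x mod 3 = y mod 3" for x y :: nat
  proof (rule ccontr)
    assume "x \<noteq> y"
    moreover have "3 dvd x - y"
      using that mod_eq_dvd_iff_nat by blast
    ultimately show False
      using that dvd_imp_le[of 3 "x - y"] by simp
  qed
  from this[of x y] this[of y x] show ?thesis
    using assms by linarith
qed

text \<open>The machines in use at time \<open>t\<close> form a static packing of the requests then
  active; this links \<open>opt_bins\<close> to the optimal schedule. The bijection \<open>h\<close>
  renumbers them from 0.\<close>

lemma packable_active: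
  assumes "feasible rs \<sigma>" and "distinct js" and js: "set js \<subseteq> active_idx rs t"
    and pos: "\<And>i. i < length rs \<Longrightarrow> 0 < weight (rs ! i)"
  shows "packable (map (\<lambda>j. weight (rs ! j)) js) (card (\<sigma> ` active_idx rs t))"
proof -
  let ?A = "active_idx rs t"
  obtain h where h: "bij_betw h (\<sigma> ` ?A) {0..<card (\<sigma> ` ?A)}"
    using ex_bij_betw_finite_nat[of "\<sigma> ` ?A"] by auto
  show ?thesis
    unfolding packable_def
  proof (intro exI[of _ "\<lambda>i. h (\<sigma> (js ! i))"] conjI allI impI)
    fix i assume "i < length (map (\<lambda>j. weight (rs ! j)) js)"
    then have "js ! i \<in> ?A"
      using js by (auto intro: nth_mem)
    then have "\<sigma> (js ! i) \<in> \<sigma> ` ?A"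
      by (rule imageI)
    then show "h (\<sigma> (js ! i)) < card (\<sigma> ` ?A)"
      using bij_betwE[OF h] by auto
  next
    fix b assume "b < card (\<sigma> ` ?A)"
    then have "b \<in> h ` (\<sigma> ` ?A)"
      unfolding bij_betw_imp_surj_on[OF h] by simp
    then obtain m where m: "m \<in> \<sigma> ` ?A" "h m = b"
      by (elim imageE) blast
    let ?I = "{i. i < length js \<and> h (\<sigma> (js ! i)) = b}"
    have inj: "inj_on ((!) js) ?I"
      using assms(2) by (auto simp: inj_on_def nth_eq_iff_index_eq)
    have "(\<Sum>i\<in>?I. map (\<lambda>j. weight (rs ! j)) js ! i) = (\<Sum>i\<in>?I. weight (rs ! (js ! i)))"
      by (intro sum.cong) auto
    also have "\<dots> = (\<Sum>j\<in>(!) js ` ?I. weight (rs ! j))"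
      by (simp add: sum.reindex[OF inj])
    also have "\<dots> \<le> (\<Sum>j\<in>{j \<in> ?A. \<sigma> j = m}. weight (rs ! j))"
    proof (rule sum_mono2)
      show "(!) js ` ?I \<subseteq> {j \<in> ?A. \<sigma> j = m}"
      proof
        fix j assume "j \<in> (!) js ` ?I"
        then obtain i where i: "i < length js" "h (\<sigma> (js ! i)) = b" "j = js ! i"
          by auto
        then have "j \<in> ?A"
          using js by auto
        moreover have "\<sigma> j = m"
          using bij_betw_imp_inj_on[OF h] m i \<open>j \<in> ?A\<close> by (auto dest: inj_onD)
        ultimately show "j \<in> {j \<in> ?A. \<sigma> j = m}"
          by simp
      qed
    qed (use pos in \<open>auto simp: active_idx_def less_imp_le\<close>)
    also have "\<dots> \<le> 1"
      using assms(1) by (simp add: feasible_def)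
    finally show "(\<Sum>i\<in>{i. i < length (map (\<lambda>j. weight (rs ! j)) js) \<and> h (\<sigma> (js ! i)) = b}.
        map (\<lambda>j. weight (rs ! j)) js ! i) \<le> 1"
      by simp
  qed
qed

section \<open>Volumes, shared machines and feasibility\<close>

locale avg_load_run =
  fixes T :: nat and rs :: "request list" and cls :: "real \<Rightarrow> nat" and J :: "nat set"
  assumes inst: "dbp_instance T rs"
    and finite_J: "finite J"
    and cls_J: "\<And>i. i < length rs \<Longrightarrow> cls (weight (rs ! i)) \<in> J"
begin

abbreviation n :: nat where "n \<equiv> length rs"
abbreviation w :: "nat \<Rightarrow> real" where "w i \<equiv> weight (rs ! i)"
abbreviation v :: real where "v \<equiv> avg_load T rs"
abbreviation cl :: "nat \<Rightarrow> nat" where "cl i \<equiv> length_class (rs ! i)"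
abbreviation ty :: "nat \<Rightarrow> nat \<times> nat" where "ty i \<equiv> type_of v (rs ! i)"
abbreviation ky :: "nat \<Rightarrow> (nat \<times> nat) \<times> nat" where "ky i \<equiv> key_of v cls (rs ! i)"
abbreviation pl :: "nat \<Rightarrow> bool" where "pl \<equiv> pooled v rs"
abbreviation bn :: "nat \<Rightarrow> nat" where "bn \<equiv> next_fit_bin v cls rs"
abbreviation kw :: "(nat \<times> nat) \<times> nat \<Rightarrow> nat \<Rightarrow> real list" where "kw \<equiv> key_weights v cls rs"

text \<open>\<open>S\<close> bounds \<open>sqrt ((i + 1) / v)\<close> for all occurring classes
  \<open>i\<close>, and \<open>Q = S * v\<close> is the unit in which all error terms are
  measured.\<close>

definition N :: nat where "N = floor_log (max_duration rs)"
definition Q :: real where "Q = sqrt (v * real (N + 1))"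
definition S :: real where "S = sqrt (real (N + 1) / v)"

lemma w_pos: "i < n \<Longrightarrow> 0 < w i" and w_le_1: "i < n \<Longrightarrow> w i \<le> 1"
  using instance_request[OF inst] by auto

lemma T_pos: "0 < T"
  using inst by (simp add: dbp_instance_def)

lemma load_pos:
  assumes "t \<in> {1..T}"
  shows "1 \<le> load rs t"
proof -
  obtain r where "r \<in> set rs" "active r t"
    using inst assms unfolding dbp_instance_def by blast
  then obtain i where i: "i < n" "i \<in> active_idx rs t"
    by (auto simp: in_set_conv_nth active_idx_def)
  have "0 < w i"
    by (rule w_pos) fact
  also have "\<dots> \<le> total_weight rs t"
    unfolding total_weight_def using i w_pos
    by (intro member_le_sum) (auto simp: active_idx_def less_imp_le)
  also have "\<dots> \<le> real (load rs t)"
    by (rule total_weight_le_load)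
  finally show ?thesis
    by simp
qed

lemma v_ge_1: "1 \<le> v"
proof -
  have "(\<Sum>t=1..T. 1) \<le> (\<Sum>t=1..T. real (load rs t))"
    using load_pos by (intro sum_mono) force
  then show ?thesis
    using T_pos by (simp add: avg_load_def field_simps)
qed

lemma Q_ge_1: "1 \<le> Q"
proof -
  have "1 * 1 \<le> v * real (N + 1)"
    using v_ge_1 by (intro mult_mono) auto
  then show ?thesis
    unfolding Q_def by (intro real_le_rsqrt) simp
qed

lemma S_times_v: "S * v = Q"
proof -
  have "S * v = sqrt (real (N + 1)) * (v / sqrt v)"
    by (simp add: S_def real_sqrt_divide)
  also have "v / sqrt v = sqrt v"
    using v_ge_1 by (intro real_div_sqrt) simp
  finally show ?thesis
    by (simp only: Q_def real_sqrt_mult mult.commute)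
qed

lemma duration_bounds:
  assumes "i < n"
  shows "2 ^ cl i \<le> finish (rs ! i) - start (rs ! i)" "finish (rs ! i) < start (rs ! i) + 2 * 2 ^ cl i"
proof -
  have "start (rs ! i) < finish (rs ! i)"
    using instance_request(2)[OF inst assms] .
  then show "2 ^ cl i \<le> finish (rs ! i) - start (rs ! i)"
    using floor_log_exp2_le[of "duration (rs ! i)"] by (simp add: length_class_def duration_def)
  show "finish (rs ! i) < start (rs ! i) + 2 * 2 ^ cl i"
    using floor_log_exp2_gt[of "duration (rs ! i)"] unfolding length_class_def duration_def
    by linarith
qed

lemma cl_le_N: "i < n \<Longrightarrow> cl i \<le> N"
  unfolding length_class_def N_def max_duration_def by (intro floor_log_le_iff Max_ge) auto

text \<open>Lengths rounded down to powers of 2 only decrease the total volume, and the volume is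
  the sum over time of the loads before rounding up.\<close>

lemma volume_le: "(\<Sum>i<n. w i * 2 ^ cl i) \<le> v * real T"
proof -
  have "(\<Sum>i<n. w i * 2 ^ cl i) \<le> (\<Sum>i<n. w i * real (card {t \<in> {1..T}. active (rs ! i) t}))"
  proof (intro sum_mono mult_left_mono)
    fix i assume "i \<in> {..<n}"
    then have i: "i < n" by simp
    have "{t \<in> {1..T}. active (rs ! i) t} = {start (rs ! i)..<finish (rs ! i)}"
      using instance_request[OF inst i] by (auto simp: active_def)
    then have "2 ^ cl i \<le> card {t \<in> {1..T}. active (rs ! i) t}"
      using duration_bounds(1)[OF i] by simp
    then show "2 ^ cl i \<le> real (card {t \<in> {1..T}. active (rs ! i) t})"
      by (metis of_nat_le_iff of_nat_numeral of_nat_power)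
    show "0 \<le> w i"
      using w_pos[OF i] by simp
  qed
  also have "\<dots> = (\<Sum>i<n. \<Sum>t=1..T. if active (rs ! i) t then w i else 0)"
    by (intro sum.cong refl) (simp add: sum.If_cases Int_def mult.commute)
  also have "\<dots> = (\<Sum>t=1..T. total_weight rs t)"
    unfolding total_weight_eq by (rule sum.swap)
  also have "\<dots> \<le> (\<Sum>t=1..T. real (load rs t))"
    by (intro sum_mono total_weight_le_load)
  also have "\<dots> = v * real T"
    using T_pos by (simp add: avg_load_def)
  finally show ?thesis .
qed

lemma pool_share_nonneg: "0 \<le> pool_share v i"
  using v_ge_1 by (simp add: pool_share_def)

lemma pool_share_bound:
  assumes "m \<le> n"
  shows "(\<Sum>j<m. if pl j \<and> ty j = \<tau> then w j else 0) \<le> pool_share v (fst \<tau>)"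
  using assms
proof (induction m)
  case 0
  then show ?case
    using pool_share_nonneg by simp
next
  case (Suc m)
  show ?case
  proof (cases "pl m \<and> ty m = \<tau>")
    case True
    then have "(\<Sum>j<m. if pl j \<and> ty j = ty m then w j else 0) + w m \<le> pool_share v (cl m)"
      using pooled.simps[of v rs m] by blast
    moreover have "cl m = fst \<tau>"
      using True by (auto simp: type_of_def)
    ultimately show ?thesis
      using True by simp
  next
    case False
    then have "(\<Sum>j<Suc m. if pl j \<and> ty j = \<tau> then w j else 0) =
        (\<Sum>j<m. if pl j \<and> ty j = \<tau> then w j else 0)"
      by auto
    then show ?thesis
      using Suc by simp
  qed
qed

lemma width_long: "v < real (i + 1) \<Longrightarrow> width v i = 2 ^ i"
proof -
  assume "v < real (i + 1)"
  then have "1 \<le> sqrt (real (i + 1) / v)"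
    using v_ge_1 by simp
  then have "max 1 (min 1 (sqrt (real (i + 1) / v)) * 2 ^ i) = 2 ^ i"
    by (simp add: min_def)
  then show "width v i = 2 ^ i"
    unfolding width_def by (metis floor_of_nat nat_int of_nat_numeral of_nat_power)
qed

text \<open>All other classes have share 0, while sizes are positive.\<close>

lemma pooled_long:
  assumes "i < n" and "pl i"
  shows "v < real (cl i + 1)"
proof (rule ccontr)
  assume "\<not> v < real (cl i + 1)"
  then have "pool_share v (cl i) = 0"
    by (simp add: pool_share_def)
  moreover have "0 \<le> (\<Sum>j<i. if pl j \<and> ty j = ty i then w j else 0)"
    using w_pos assms(1) by (intro sum_nonneg) (auto simp: less_imp_le)
  ultimately show False
    using assms w_pos[OF assms(1)] pooled.simps[of v rs i] by auto
qed

text \<open>A request of class \<open>i\<close> active at \<open>t\<close> departs after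
  \<open>t\<close>, but less than \<open>2 * 2 ^ i\<close> later, and windows of a long class have
  width \<open>2 ^ i\<close>: only three windows remain.\<close>

lemma long_window:
  assumes "i < n" and "v < real (cl i + 1)" and "active (rs ! i) t"
  shows "t div 2 ^ cl i \<le> snd (ty i)" and "snd (ty i) \<le> t div 2 ^ cl i + 2"
proof -
  have ty: "snd (ty i) = finish (rs ! i) div 2 ^ cl i"
    using width_long[OF assms(2)] by (simp add: type_of_def)
  have "t \<le> finish (rs ! i)" "finish (rs ! i) \<le> t + 2 * 2 ^ cl i"
    using assms(3) duration_bounds(2)[OF assms(1)] by (auto simp: active_def)
  then have "t div 2 ^ cl i \<le> finish (rs ! i) div 2 ^ cl i"
    "finish (rs ! i) div 2 ^ cl i \<le> (t + 2 * 2 ^ cl i) div 2 ^ cl i"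
    by (intro div_le_mono; simp)+
  then show "t div 2 ^ cl i \<le> snd (ty i)" "snd (ty i) \<le> t div 2 ^ cl i + 2"
    by (auto simp: ty)
qed

text \<open>Classes with the same \<open>m\<close> satisfy
  \<open>m^2 \<le> v * (i + 1) < (m + 1)^2\<close>, so there are at most
  \<open>(2 * m + 1) / v + 1\<close> of them, each with share at most \<open>v / (5 * m)\<close>. As
  \<open>v < m + 1\<close> and \<open>1 \<le> m\<close>, the sum is at most
  \<open>(3 * m + 2) / (5 * m) \<le> 1\<close>.\<close>

lemma pool_shares_fit:
  fixes m :: nat
  defines "I \<equiv> {i. v < real (i + 1) \<and> nat \<lfloor>sqrt (v * real (i + 1))\<rfloor> = m}"
  shows "finite I" and "(\<Sum>i\<in>I. pool_share v i) \<le> 1"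
proof -
  have I: "real m \<le> sqrt (v * real (i + 1))" "sqrt (v * real (i + 1)) < real m + 1"
      "v < real m + 1" "1 \<le> m" if "i \<in> I" for i
  proof -
    have i: "v < real (i + 1)" "nat \<lfloor>sqrt (v * real (i + 1))\<rfloor> = m"
      using that by (auto simp: I_def)
    have "v * v < v * real (i + 1)"
      using i(1) v_ge_1 by (intro mult_strict_left_mono) auto
    then have gt: "v < sqrt (v * real (i + 1))"
      using v_ge_1 by (simp add: real_less_rsqrt power2_eq_square)
    then have "0 \<le> \<lfloor>sqrt (v * real (i + 1))\<rfloor>"
      using v_ge_1 by simp
    then have m: "int m = \<lfloor>sqrt (v * real (i + 1))\<rfloor>"
      using i(2) by linarith
    show "real m \<le> sqrt (v * real (i + 1))" and less: "sqrt (v * real (i + 1)) < real m + 1"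
      using m by linarith+
    show "v < real m + 1"
      using gt less by linarith
    show "1 \<le> m"
      using gt v_ge_1 m by linarith
  qed
  have sq: "(real m)\<^sup>2 / v \<le> real (Suc i)" "real (Suc i) < (real m + 1)\<^sup>2 / v" if "i \<in> I" for i
  proof -
    have "(real m)\<^sup>2 \<le> (sqrt (v * real (i + 1)))\<^sup>2"
      by (rule power_mono[OF I(1)[OF that]]) simp
    moreover have "(sqrt (v * real (i + 1)))\<^sup>2 < (real m + 1)\<^sup>2"
      using v_ge_1 by (intro power_strict_mono[OF I(2)[OF that]]) auto
    ultimately show "(real m)\<^sup>2 / v \<le> real (Suc i)" "real (Suc i) < (real m + 1)\<^sup>2 / v"
      using v_ge_1 by (auto simp: field_simps)
  qed
  have le: "(real m)\<^sup>2 / v \<le> (real m + 1)\<^sup>2 / v"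
    using v_ge_1 by (intro divide_right_mono power_mono) auto
  have sub: "Suc ` I \<subseteq> {x. (real m)\<^sup>2 / v \<le> real x \<and> real x < (real m + 1)\<^sup>2 / v}"
    using sq by auto
  have nn: "0 \<le> (real m)\<^sup>2 / v"
    using v_ge_1 by simp
  have "finite (Suc ` I)" and card: "real (card (Suc ` I)) \<le> (real m + 1)\<^sup>2 / v - (real m)\<^sup>2 / v + 1"
    using card_nat_interval_le[OF nn le sub] by auto
  then show "finite I"
    by (simp add: finite_image_iff)
  show "(\<Sum>i\<in>I. pool_share v i) \<le> 1"
  proof (cases "I = {}")
    case False
    then have m: "v < real m + 1" "1 \<le> m"
      using I by blast+
    have "pool_share v i \<le> v / real m / 5" if "i \<in> I" for i
    proof -
      have pos: "0 < sqrt (v * real (i + 1))"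
        using v_ge_1 by simp
      have "sqrt (v / real (i + 1)) * sqrt (v * real (i + 1)) = sqrt (v * v)"
        unfolding real_sqrt_mult[symmetric] by simp
      then have "sqrt (v / real (i + 1)) = v / sqrt (v * real (i + 1))"
        using v_ge_1 pos by (simp add: field_simps)
      also have "\<dots> \<le> v / real m"
        using I[OF that] v_ge_1 pos by (intro divide_left_mono) auto
      finally show ?thesis
        using that by (simp add: pool_share_def I_def)
    qed
    then have "(\<Sum>i\<in>I. pool_share v i) \<le> real (card I) * (v / real m / 5)"
      using sum_bounded_above[of I "pool_share v" "v / real m / 5"] by simp
    also have "\<dots> \<le> ((2 * real m + 1) / v + 1) * (v / real m / 5)"
    proof (rule mult_right_mono)
      have "(real m + 1)\<^sup>2 / v - (real m)\<^sup>2 / v = (2 * real m + 1) / v"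
        by (simp add: diff_divide_distrib[symmetric] power2_sum)
      then show "real (card I) \<le> (2 * real m + 1) / v + 1"
        using card by (simp add: card_image)
    qed (use v_ge_1 in simp)
    also have "\<dots> = (2 * real m + 1 + v) / (5 * real m)"
      using v_ge_1 m by (simp add: field_simps)
    also have "\<dots> \<le> 1"
      using m by (simp add: field_simps)
    finally show ?thesis .
  qed simp
qed

text \<open>On one pool machine at one time, requests of equal class have equal type, because three
  consecutive windows have distinct residues. So each class contributes at most its share, and the
  shares fit.\<close>

lemma pool_capacity:
  "(\<Sum>j<n. if active (rs ! j) t \<and> pl j \<and> pool_machine v (rs ! j) = m then w j else 0) \<le> 1"
proof -
  define A where "A = {j. j < n \<and> active (rs ! j) t \<and> pl j \<and> pool_machine v (rs ! j) = m}"
  define I where "I = {i. v < real (i + 1) \<and> nat \<lfloor>sqrt (v * real (i + 1))\<rfloor> = fst m}"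
  have fin: "finite A"
    by (simp add: A_def)
  have long: "v < real (cl j + 1)" if "j \<in> A" for j
    using that pooled_long by (simp add: A_def)
  have same: "ty j = ty k" if "j \<in> A" "k \<in> A" "cl j = cl k" for j k
  proof -
    have mods: "snd (ty j) mod 3 = snd (ty k) mod 3"
      using that unfolding A_def pool_machine_def by (metis (mono_tags, lifting) mem_Collect_eq snd_conv)
    have "t div 2 ^ cl j \<le> snd (ty j)" "snd (ty j) \<le> t div 2 ^ cl j + 2"
      "t div 2 ^ cl j \<le> snd (ty k)" "snd (ty k) \<le> t div 2 ^ cl j + 2"
      using long_window[of j t] long_window[of k t] long that by (auto simp: A_def)
    then have "snd (ty j) = snd (ty k)"
      using mods by (rule residue_close)
    moreover have "fst (ty j) = fst (ty k)"
      using that by (simp add: type_of_def)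
    ultimately show ?thesis
      by (rule prod_eqI[rotated])
  qed
  have "(\<Sum>j<n. if active (rs ! j) t \<and> pl j \<and> pool_machine v (rs ! j) = m then w j else 0) = sum w A"
    by (subst sum.inter_filter[symmetric]) (auto simp: A_def intro!: sum.cong)
  also have "\<dots> = (\<Sum>i\<in>cl ` A. sum w {j \<in> A. cl j = i})"
    by (rule sum.image_gen[OF fin])
  also have "\<dots> \<le> (\<Sum>i\<in>cl ` A. pool_share v i)"
  proof (rule sum_mono)
    fix i assume "i \<in> cl ` A"
    then obtain k where k: "k \<in> A" "cl k = i"
      by blast
    have "sum w {j \<in> A. cl j = i} \<le> sum w {j. j < n \<and> pl j \<and> ty j = ty k}"
    proof (rule sum_mono2)
      show "{j \<in> A. cl j = i} \<subseteq> {j. j < n \<and> pl j \<and> ty j = ty k}"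
        using same[OF _ k(1)] k(2) by (auto simp: A_def)
    qed (use w_pos in \<open>auto simp: less_imp_le\<close>)
    also have "\<dots> = (\<Sum>j<n. if pl j \<and> ty j = ty k then w j else 0)"
      by (subst sum.inter_filter[symmetric]) (auto intro!: sum.cong)
    also have "\<dots> \<le> pool_share v (fst (ty k))"
      by (rule pool_share_bound) simp
    finally show "sum w {j \<in> A. cl j = i} \<le> pool_share v i"
      using k(2) by (simp add: type_of_def)
  qed
  also have "\<dots> \<le> (\<Sum>i\<in>I. pool_share v i)"
  proof (rule sum_mono2)
    show "finite I"
      unfolding I_def by (rule pool_shares_fit(1))
    show "cl ` A \<subseteq> I"
      using long by (auto simp: A_def I_def pool_machine_def)
  qed (rule pool_share_nonneg)
  also have "\<dots> \<le> 1"
    unfolding I_def by (rule pool_shares_fit(2))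
  finally show ?thesis .
qed

lemma kw_Suc:
  "kw \<kappa> (Suc m) = kw \<kappa> m @ (if \<not> pl m \<and> ky m = \<kappa> then [w m] else [])"
  by (simp add: key_weights_def)

lemma set_kw:
  assumes "m \<le> n"
  shows "set (kw \<kappa> m) \<subseteq> {0<..1}"
  using w_pos w_le_1 assms by (auto simp: key_weights_def)

text \<open>The induction carries the state of Next-Fit along. The current bin is only bounded by
  \<open>end_level\<close>, since initially the fictitious full bin 0 holds nothing. Time does not
  enter: even all requests ever put into a bin have total size at most 1.\<close>

lemma class_capacity:
  fixes \<kappa> :: "(nat \<times> nat) \<times> nat"
  assumes "m \<le> n"
  defines "B \<equiv> \<lambda>b. \<Sum>j<m. if \<not> pl j \<and> ky j = \<kappa> \<and> bn j = b then w j else 0"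
  shows "B b \<le> 1 \<and> B (next_fit_from 1 (kw \<kappa> m)) \<le> end_level 1 (kw \<kappa> m) \<and>
    (\<forall>b>next_fit_from 1 (kw \<kappa> m). B b = 0)"
  using assms(1) unfolding B_def
proof (induction m arbitrary: b)
  case 0
  then show ?case
    by (simp add: key_weights_def)
next
  case (Suc m)
  let ?B = "\<lambda>m b. \<Sum>j<m. if \<not> pl j \<and> ky j = \<kappa> \<and> bn j = b then w j else 0"
  let ?l = "kw \<kappa> m"
  have IH: "?B m b \<le> 1" "?B m (next_fit_from 1 ?l) \<le> end_level 1 ?l"
      "\<And>b. b > next_fit_from 1 ?l \<Longrightarrow> ?B m b = 0" for b
    using Suc.IH[of b] Suc.prems by auto
  show ?case
  proof (cases "\<not> pl m \<and> ky m = \<kappa>")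
    case False
    then have "kw \<kappa> (Suc m) = ?l" "\<And>b. ?B (Suc m) b = ?B m b"
      by (auto simp: kw_Suc)
    then show ?thesis
      using IH by simp
  next
    case True
    then have kw: "kw \<kappa> (Suc m) = ?l @ [w m]"
      by (simp add: kw_Suc)
    then have bn: "bn m = next_fit_from 1 (?l @ [w m])"
      using True by (simp add: next_fit_bin_def)
    have B: "?B (Suc m) b = ?B m b + (if b = bn m then w m else 0)" for b
      using True by simp
    have w: "0 < w m" "w m \<le> 1"
      using w_pos w_le_1 Suc.prems by auto
    show ?thesis
    proof (cases "end_level 1 ?l + w m \<le> 1")
      case fits: True
      then have "bn m = next_fit_from 1 ?l" "end_level 1 (?l @ [w m]) = end_level 1 ?l + w m"
        by (simp_all add: bn next_fit_from_append end_level_append)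
      then show ?thesis
        using IH fits w unfolding kw B bn[symmetric] by force
    next
      case False
      then have "bn m = Suc (next_fit_from 1 ?l)" "end_level 1 (?l @ [w m]) = w m"
        by (simp_all add: bn next_fit_from_append end_level_append)
      then show ?thesis
        using IH w unfolding kw B bn[symmetric] by force
    qed
  qed
qed

lemma class_machine_feasible: "feasible rs (schedule_with_avg_load (avg_load_alg cls) T rs)"
proof (rule feasible_to_natI)
  fix t m
  let ?M = "class_machine v cls rs"
  show "(\<Sum>i<n. if active (rs ! i) t \<and> ?M i = m then w i else 0) \<le> 1"
  proof (cases m)
    case (Inl p)
    then have "(\<Sum>i<n. if active (rs ! i) t \<and> ?M i = m then w i else 0) =
        (\<Sum>i<n. if active (rs ! i) t \<and> pl i \<and> pool_machine v (rs ! i) = p then w i else 0)"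
      by (intro sum.cong) (auto simp: class_machine_def)
    then show ?thesis
      using pool_capacity by simp
  next
    case (Inr q)
    then have "(\<Sum>i<n. if active (rs ! i) t \<and> ?M i = m then w i else 0) \<le>
        (\<Sum>i<n. if \<not> pl i \<and> ky i = fst q \<and> bn i = snd q then w i else 0)"
      using w_pos by (intro sum_mono) (auto simp: class_machine_def less_imp_le)
    also have "\<dots> \<le> 1"
      using class_capacity[of n] by blast
    finally show ?thesis .
  qed
qed (use avg_load_schedule w_pos in auto)

section \<open>Counting machines at each time step\<close>

definition unpooled :: "nat set" where
  "unpooled = {i. i < n \<and> \<not> pl i}"

definition keys :: "nat \<Rightarrow> ((nat \<times> nat) \<times> nat) set" where
  "keys t = ky ` {i \<in> active_idx rs t. \<not> pl i}"

text \<open>The departure window of the key has begun, so some of its requests may have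
  left.\<close>

definition departing :: "nat \<Rightarrow> (nat \<times> nat) \<times> nat \<Rightarrow> bool" where
  "departing t \<kappa> \<longleftrightarrow> snd (fst \<kappa>) * width v (fst (fst \<kappa>)) \<le> t"

definition active_weights :: "nat \<Rightarrow> (nat \<times> nat) \<times> nat \<Rightarrow> real list" where
  "active_weights t \<kappa> = map w (filter (\<lambda>j. \<not> pl j \<and> ky j = \<kappa> \<and> active (rs ! j) t) [0..<n])"

definition key_volume :: "(nat \<times> nat) \<times> nat \<Rightarrow> real" where
  "key_volume \<kappa> = sum w {j \<in> unpooled. ky j = \<kappa>}"

lemma finite_keys [simp]: "finite (keys t)"
  by (simp add: keys_def)

lemma finite_unpooled [simp]: "finite unpooled"
  by (simp add: unpooled_def)

lemma keys_subset: "keys t \<subseteq> ky ` unpooled"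
  by (auto simp: keys_def unpooled_def active_idx_def)

lemma key_volume_nonneg: "0 \<le> key_volume \<kappa>"
  unfolding key_volume_def using w_pos by (intro sum_nonneg) (auto simp: unpooled_def less_imp_le)

lemma width_pos: "0 < width v i"
  by (simp add: width_def le_floor_iff)

lemma kw_mono:
  assumes "i \<le> m"
  shows "\<exists>ys. kw \<kappa> m = kw \<kappa> i @ ys"
proof -
  have "[0..<m] = [0..<i] @ [i..<m]"
    using upt_add_eq_append[of 0 i "m - i"] assms by simp
  then show ?thesis
    by (simp add: key_weights_def)
qed

lemma bn_pos:
  assumes "i < n" and "\<not> pl i"
  shows "1 \<le> bn i"
proof -
  have "kw (ky i) (Suc i) \<noteq> []"
    using assms by (simp add: kw_Suc)
  moreover have "set (kw (ky i) (Suc i)) \<subseteq> {0<..1}"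
    using assms by (intro set_kw) simp
  ultimately show ?thesis
    unfolding next_fit_bin_def by (cases "kw (ky i) (Suc i)") auto
qed

lemma bn_le_total:
  assumes "i < n"
  shows "bn i \<le> next_fit_from 1 (kw (ky i) n)"
  using kw_mono[of "Suc i" n "ky i"] assms next_fit_append_mono
  unfolding next_fit_bin_def by (metis Suc_leI)

lemma sum_list_kw: "sum_list (kw \<kappa> n) = key_volume \<kappa>"
  unfolding key_weights_def key_volume_def unpooled_def
  by (subst sum_list_distinct_conv_sum_set) (auto intro!: sum.cong)

text \<open>Before the window begins no request of the key has departed, and those that arrived
  before \<open>i\<close> have started. Hence what Next-Fit has packed up to \<open>i\<close> is a
  prefix of the list of active requests of the key.\<close>

lemma bn_le_active:
  assumes i: "i \<in> active_idx rs t" "\<not> pl i" and nondep: "\<not> departing t (ky i)"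
  shows "bn i \<le> next_fit_from 1 (active_weights t (ky i))"
proof -
  have in_: "i < n" "active (rs ! i) t"
    using i by (auto simp: active_idx_def)
  have "active (rs ! j) t" if "j \<le> i" "ky j = ky i" for j
  proof -
    have "start (rs ! j) \<le> t"
      using instance_start_mono[OF inst \<open>j \<le> i\<close> in_(1)] in_(2) by (simp add: active_def)
    moreover have "t < finish (rs ! j)"
    proof -
      have ty: "ty j = ty i"
        using that(2) by (simp add: key_of_def)
      then have cl: "cl j = cl i"
        by (simp add: type_of_def)
      have "t < snd (ty j) * width v (cl j)"
        using nondep by (simp add: departing_def key_of_def ty cl) (simp add: type_of_def)
      also have "\<dots> \<le> finish (rs ! j)"
        by (simp add: type_of_def)
      finally show ?thesis .
    qed
    ultimately show ?thesis
      by (simp add: active_def)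
  qed
  then have "kw (ky i) (Suc i) =
      map w (filter (\<lambda>j. \<not> pl j \<and> ky j = ky i \<and> active (rs ! j) t) [0..<Suc i])"
    unfolding key_weights_def by (intro arg_cong[of _ _ "map w"] filter_cong) auto
  moreover have "[0..<n] = [0..<Suc i] @ [Suc i..<n]"
    using upt_add_eq_append[of 0 "Suc i" "n - Suc i"] in_(1)
    by (simp only: le_add_diff_inverse Suc_leI le0)
  ultimately have "active_weights t (ky i) = kw (ky i) (Suc i) @
      map w (filter (\<lambda>j. \<not> pl j \<and> ky j = ky i \<and> active (rs ! j) t) [Suc i..<n])"
    by (simp only: active_weights_def filter_append map_append)
  then show ?thesis
    by (simp only: next_fit_bin_def next_fit_append_mono)
qed

lemma set_active_weights: "set (active_weights t \<kappa>) \<subseteq> {0<..1}"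
  using w_pos w_le_1 by (auto simp: active_weights_def)

definition pool_machines :: "nat \<Rightarrow> (nat \<times> nat) set" where
  "pool_machines t = (\<lambda>i. pool_machine v (rs ! i)) ` {i \<in> active_idx rs t. pl i}"

text \<open>Once the window of a key has begun, a few remaining requests may keep many bins in use.
  All bins that the key ever opens are counted then, at most 1 plus twice its total size.\<close>

lemma machines_le:
  "real (card (class_machine v cls rs ` active_idx rs t)) \<le> real (card (pool_machines t)) +
     (\<Sum>\<kappa>\<in>{\<kappa> \<in> keys t. \<not> departing t \<kappa>}. real (next_fit (active_weights t \<kappa>))) +
     (\<Sum>\<kappa>\<in>{\<kappa> \<in> keys t. departing t \<kappa>}. 1 + 2 * key_volume \<kappa>)"
proof -
  define B where "B \<kappa> = bn ` {i \<in> active_idx rs t. \<not> pl i \<and> ky i = \<kappa>}" for \<kappa>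
  have finB: "finite (B \<kappa>)" for \<kappa>
    by (simp add: B_def)
  let ?I = "Inl ` pool_machines t :: ((nat \<times> nat) + ((nat \<times> nat) \<times> nat) \<times> nat) set"
  let ?R = "(\<Union>\<kappa>\<in>keys t. (\<lambda>b. Inr (\<kappa>, b)) ` B \<kappa>) :: ((nat \<times> nat) + ((nat \<times> nat) \<times> nat) \<times> nat) set"
  have "class_machine v cls rs ` active_idx rs t \<subseteq> ?I \<union> ?R"
    by (auto simp: class_machine_def pool_machines_def keys_def B_def)
  then have "card (class_machine v cls rs ` active_idx rs t) \<le> card (?I \<union> ?R)"
    using finB by (intro card_mono) (auto simp: pool_machines_def)
  also have "\<dots> \<le> card ?I + card ?R"
    by (rule card_Un_le)
  also have "card ?I = card (pool_machines t)"
    by (simp add: card_image)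
  also have "card ?R \<le> (\<Sum>\<kappa>\<in>keys t. card ((\<lambda>b. Inr (\<kappa>, b)) ` B \<kappa> ::
      ((nat \<times> nat) + ((nat \<times> nat) \<times> nat) \<times> nat) set))"
    by (rule card_UN_le) simp
  also have "\<dots> = (\<Sum>\<kappa>\<in>keys t. card (B \<kappa>))"
    by (intro sum.cong refl card_image) (auto simp: inj_on_def)
  also have "\<dots> = (\<Sum>\<kappa>\<in>{\<kappa> \<in> keys t. \<not> departing t \<kappa>}. card (B \<kappa>)) +
      (\<Sum>\<kappa>\<in>{\<kappa> \<in> keys t. departing t \<kappa>}. card (B \<kappa>))"
    by (subst sum.union_disjoint[symmetric]) (auto intro!: sum.cong)
  finally have "real (card (class_machine v cls rs ` active_idx rs t)) \<le> real (card (pool_machines t)) +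
      (\<Sum>\<kappa>\<in>{\<kappa> \<in> keys t. \<not> departing t \<kappa>}. real (card (B \<kappa>))) +
      (\<Sum>\<kappa>\<in>{\<kappa> \<in> keys t. departing t \<kappa>}. real (card (B \<kappa>)))"
    by (simp flip: of_nat_sum of_nat_add)
  moreover have "(\<Sum>\<kappa>\<in>{\<kappa> \<in> keys t. \<not> departing t \<kappa>}. real (card (B \<kappa>))) \<le>
      (\<Sum>\<kappa>\<in>{\<kappa> \<in> keys t. \<not> departing t \<kappa>}. real (next_fit (active_weights t \<kappa>)))"
  proof (rule sum_mono)
    fix \<kappa> assume \<kappa>: "\<kappa> \<in> {\<kappa> \<in> keys t. \<not> departing t \<kappa>}"
    have "B \<kappa> \<subseteq> {1..next_fit (active_weights t \<kappa>)}"
    proof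
      fix b assume "b \<in> B \<kappa>"
      then obtain i where i: "i \<in> active_idx rs t" "\<not> pl i" "ky i = \<kappa>" "b = bn i"
        by (auto simp: B_def)
      have "next_fit (active_weights t \<kappa>) = next_fit_from 1 (active_weights t \<kappa>)"
        using set_active_weights by (intro next_fit_eq_from_1) fastforce
      then show "b \<in> {1..next_fit (active_weights t \<kappa>)}"
        using bn_le_active[OF i(1,2)] bn_pos[of i] i \<kappa> by (auto simp: active_idx_def)
    qed
    then have "card (B \<kappa>) \<le> card {1..next_fit (active_weights t \<kappa>)}"
      by (intro card_mono) auto
    then show "real (card (B \<kappa>)) \<le> real (next_fit (active_weights t \<kappa>))"
      by simp
  qed
  moreover have "(\<Sum>\<kappa>\<in>{\<kappa> \<in> keys t. departing t \<kappa>}. real (card (B \<kappa>))) \<le>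
      (\<Sum>\<kappa>\<in>{\<kappa> \<in> keys t. departing t \<kappa>}. 1 + 2 * key_volume \<kappa>)"
  proof (rule sum_mono)
    fix \<kappa> assume \<kappa>: "\<kappa> \<in> {\<kappa> \<in> keys t. departing t \<kappa>}"
    have "B \<kappa> \<subseteq> {1..next_fit_from 1 (kw \<kappa> n)}"
      using bn_pos bn_le_total by (auto simp: B_def active_idx_def)
    then have "card (B \<kappa>) \<le> card {1..next_fit_from 1 (kw \<kappa> n)}"
      by (intro card_mono) auto
    then have "real (card (B \<kappa>)) \<le> real (next_fit_from 1 (kw \<kappa> n))"
      by simp
    also have "\<dots> \<le> 1 + 2 * key_volume \<kappa>"
    proof -
      have "set (kw \<kappa> n) \<subseteq> {0..}"
        using set_kw[of n \<kappa>] by fastforce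
      then show ?thesis
        using next_fit_from_le_volume[of "kw \<kappa> n" 1] by (simp add: sum_list_kw)
    qed
    finally show "real (card (B \<kappa>)) \<le> 1 + 2 * key_volume \<kappa>" .
  qed
  ultimately show ?thesis
    by linarith
qed

text \<open>The first components reach at most \<open>Q\<close>, with three residues each, and
  \<open>3 * (Q + 1)\<close> is at most \<open>6 * Q\<close> because
  \<open>1 \<le> Q\<close>.\<close>

lemma pool_machines_bound: "real (card (pool_machines t)) \<le> 6 * Q"
proof -
  have "pool_machines t \<subseteq> {..nat \<lfloor>Q\<rfloor>} \<times> {..<3}"
  proof
    fix p assume "p \<in> pool_machines t"
    then obtain i where i: "i < n" "p = pool_machine v (rs ! i)"
      by (auto simp: pool_machines_def active_idx_def)
    have "sqrt (v * real (cl i + 1)) \<le> Q"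
      unfolding Q_def using cl_le_N[OF i(1)] v_ge_1 by (intro real_sqrt_le_mono mult_left_mono) auto
    then have "nat \<lfloor>sqrt (v * real (cl i + 1))\<rfloor> \<le> nat \<lfloor>Q\<rfloor>"
      by (intro nat_mono floor_mono)
    then show "p \<in> {..nat \<lfloor>Q\<rfloor>} \<times> {..<3}"
      by (simp add: i(2) pool_machine_def)
  qed
  then have "card (pool_machines t) \<le> card ({..nat \<lfloor>Q\<rfloor>} \<times> {..<3::nat})"
    by (intro card_mono) auto
  also have "\<dots> = (nat \<lfloor>Q\<rfloor> + 1) * 3"
    by (simp add: card_cartesian_product)
  finally have "real (card (pool_machines t)) \<le> real ((nat \<lfloor>Q\<rfloor> + 1) * 3)"
    by (simp only: of_nat_le_iff)
  then have "real (card (pool_machines t)) \<le> (real (nat \<lfloor>Q\<rfloor>) + 1) * 3"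
    by simp
  moreover have "real (nat \<lfloor>Q\<rfloor>) \<le> Q"
    using Q_ge_1 by (intro of_nat_floor) simp
  ultimately show ?thesis
    using Q_ge_1 by argo
qed

lemma ratio_le_S:
  assumes "i \<le> N"
  shows "sqrt (real (i + 1) / v) \<le> S"
  unfolding S_def using assms v_ge_1 by (intro real_sqrt_le_mono divide_right_mono) auto

text \<open>After exchanging the sums, a key of class \<open>i\<close> is charged its total size at
  no more than \<open>S * 2 ^ i\<close> times. Over all requests this is at most \<open>S\<close>
  times the volume, and \<open>S * v = Q\<close>.\<close>

lemma departing_volume:
  "(\<Sum>t=1..T. \<Sum>\<kappa>\<in>{\<kappa> \<in> keys t. departing t \<kappa>}. key_volume \<kappa>) \<le> Q * real T"
proof -
  let ?K = "ky ` unpooled"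
  let ?D = "\<lambda>\<kappa>. {t \<in> {1..T}. \<kappa> \<in> keys t \<and> departing t \<kappa>}"
  have "(\<Sum>t=1..T. \<Sum>\<kappa>\<in>{\<kappa> \<in> keys t. departing t \<kappa>}. key_volume \<kappa>) =
      (\<Sum>t=1..T. \<Sum>\<kappa>\<in>?K. if \<kappa> \<in> keys t \<and> departing t \<kappa> then key_volume \<kappa> else 0)"
  proof (rule sum.cong[OF refl])
    fix t
    have "{\<kappa> \<in> keys t. departing t \<kappa>} = {\<kappa> \<in> ?K. \<kappa> \<in> keys t \<and> departing t \<kappa>}"
      using keys_subset by blast
    then show "(\<Sum>\<kappa>\<in>{\<kappa> \<in> keys t. departing t \<kappa>}. key_volume \<kappa>) =
        (\<Sum>\<kappa>\<in>?K. if \<kappa> \<in> keys t \<and> departing t \<kappa> then key_volume \<kappa> else 0)"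
      by (simp add: sum.inter_filter)
  qed
  also have "\<dots> = (\<Sum>\<kappa>\<in>?K. \<Sum>t=1..T. if \<kappa> \<in> keys t \<and> departing t \<kappa> then key_volume \<kappa> else 0)"
    by (rule sum.swap)
  also have "\<dots> = (\<Sum>\<kappa>\<in>?K. key_volume \<kappa> * real (card (?D \<kappa>)))"
    by (intro sum.cong refl) (simp add: sum.If_cases Int_def mult.commute)
  also have "\<dots> \<le> (\<Sum>\<kappa>\<in>?K. key_volume \<kappa> * (S * 2 ^ fst (fst \<kappa>)))"
  proof (intro sum_mono mult_left_mono key_volume_nonneg)
    fix \<kappa> assume "\<kappa> \<in> ?K"
    then obtain j where j: "j < n" "ky j = \<kappa>"
      by (auto simp: unpooled_def)
    define i where "i = fst (fst \<kappa>)"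
    define W where "W = width v i"
    have "0 < W"
      by (simp add: W_def width_pos)
    \<comment> \<open>Even a request departing at the last step of the window is inactive at that
      step, so \<open>W - 1\<close> steps count instead of \<open>W\<close>. In particular windows
      of width 1 cost nothing, which matters where the width had to be raised to 1.\<close>
    have "?D \<kappa> \<subseteq> {snd (fst \<kappa>) * W..<snd (fst \<kappa>) * W + (W - 1)}"
    proof
      fix t assume t: "t \<in> ?D \<kappa>"
      then obtain k where k: "k \<in> active_idx rs t" "ky k = \<kappa>"
        by (auto simp: keys_def)
      then have "finish (rs ! k) div W = snd (fst \<kappa>)"
        by (auto simp: key_of_def type_of_def W_def i_def)
      then have "finish (rs ! k) < snd (fst \<kappa>) * W + W"
        using \<open>0 < W\<close> by (metis dividend_less_times_div add.commute mult.commute)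
      moreover have "t < finish (rs ! k)"
        using k by (simp add: active_idx_def active_def)
      ultimately show "t \<in> {snd (fst \<kappa>) * W..<snd (fst \<kappa>) * W + (W - 1)}"
        using t by (auto simp: departing_def W_def i_def)
    qed
    then have "card (?D \<kappa>) \<le> W - 1"
      using card_mono[of "{snd (fst \<kappa>) * W..<snd (fst \<kappa>) * W + (W - 1)}"] by simp
    moreover have "real (W - 1) \<le> S * 2 ^ i"
    proof -
      define y where "y = min 1 (sqrt (real (i + 1) / v)) * 2 ^ i"
      have "0 \<le> y"
        using v_ge_1 by (simp add: y_def)
      have "W = nat \<lfloor>max 1 y\<rfloor>"
        by (simp add: W_def width_def y_def)
      moreover have "1 \<le> \<lfloor>max 1 y\<rfloor>"
        by (simp add: le_floor_iff)
      ultimately have "real (W - 1) \<le> y"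
        using \<open>0 \<le> y\<close> by linarith
      also have "i \<le> N"
        using cl_le_N[OF j(1)] j(2) by (auto simp: i_def key_of_def type_of_def)
      then have "y \<le> S * 2 ^ i"
        unfolding y_def using ratio_le_S[of i] by (intro mult_right_mono) auto
      finally show ?thesis .
    qed
    ultimately show "real (card (?D \<kappa>)) \<le> S * 2 ^ fst (fst \<kappa>)"
      unfolding i_def[symmetric] by linarith
  qed
  also have "\<dots> = (\<Sum>\<kappa>\<in>?K. \<Sum>j\<in>{j \<in> unpooled. ky j = \<kappa>}. S * (w j * 2 ^ cl j))"
    unfolding key_volume_def sum_distrib_right
    by (intro sum.cong refl) (auto simp: key_of_def type_of_def)
  also have "\<dots> = (\<Sum>j\<in>unpooled. S * (w j * 2 ^ cl j))"
    by (rule sum.image_gen[symmetric]) simp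
  also have "\<dots> \<le> (\<Sum>j<n. S * (w j * 2 ^ cl j))"
    using w_pos v_ge_1 by (intro sum_mono2) (auto simp: unpooled_def S_def less_imp_le)
  also have "\<dots> = S * (\<Sum>j<n. w j * 2 ^ cl j)"
    by (simp add: sum_distrib_left)
  also have "\<dots> \<le> S * (v * real T)"
    using volume_le v_ge_1 by (intro mult_left_mono) (auto simp: S_def)
  finally show ?thesis
    by (simp add: S_times_v[symmetric] mult.assoc)
qed

text \<open>Class \<open>i\<close> has at most \<open>6 / s\<close> windows in use at
  \<open>t\<close>, where \<open>s = sqrt ((i + 1) / v)\<close>. The sum of \<open>1 / s\<close>
  over the classes is \<open>sqrt v\<close> times a sum of inverse square roots, at most
  \<open>2 * Q\<close>.\<close>

lemma short_keys_bound:
  "real (card {\<kappa> \<in> keys t. real (fst (fst \<kappa>) + 1) \<le> v}) \<le> 12 * real (card J) * Q"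
proof -
  define I where "I = {i. i < N + 1 \<and> real (i + 1) \<le> v}"
  define Win where "Win i = {t div width v i..(t + 2 * 2 ^ i) div width v i}" for i
  have "{\<kappa> \<in> keys t. real (fst (fst \<kappa>) + 1) \<le> v} \<subseteq> (\<Union>i\<in>I. ({i} \<times> Win i) \<times> J)"
  proof
    fix \<kappa> assume \<kappa>: "\<kappa> \<in> {\<kappa> \<in> keys t. real (fst (fst \<kappa>) + 1) \<le> v}"
    then obtain j where j: "j < n" "active (rs ! j) t" "\<kappa> = ky j"
      by (auto simp: keys_def active_idx_def)
    have "t \<le> finish (rs ! j)" "finish (rs ! j) \<le> t + 2 * 2 ^ cl j"
      using duration_bounds(2)[OF j(1)] j(2) by (auto simp: active_def)
    then have "snd (ty j) \<in> Win (cl j)"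
      by (auto simp: Win_def type_of_def intro!: div_le_mono)
    moreover have "cl j \<in> I"
      using \<kappa> j cl_le_N[OF j(1)] by (auto simp: I_def key_of_def type_of_def)
    ultimately show "\<kappa> \<in> (\<Union>i\<in>I. ({i} \<times> Win i) \<times> J)"
      using cls_J[OF j(1)] by (auto simp: j(3) key_of_def type_of_def intro!: bexI[of _ "cl j"])
  qed
  then have "card {\<kappa> \<in> keys t. real (fst (fst \<kappa>) + 1) \<le> v} \<le> card (\<Union>i\<in>I. ({i} \<times> Win i) \<times> J)"
    using finite_J by (intro card_mono) (auto simp: I_def Win_def)
  also have "\<dots> \<le> (\<Sum>i\<in>I. card (({i} \<times> Win i) \<times> J))"
    by (intro card_UN_le) (simp add: I_def)
  also have "\<dots> = (\<Sum>i\<in>I. card (Win i) * card J)"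
    by (simp add: card_cartesian_product)
  finally have "real (card {\<kappa> \<in> keys t. real (fst (fst \<kappa>) + 1) \<le> v}) \<le>
      (\<Sum>i\<in>I. real (card (Win i)) * real (card J))"
    by (simp flip: of_nat_sum of_nat_mult)
  also have "\<dots> \<le> (\<Sum>i\<in>I. 6 * sqrt v * (1 / sqrt (real (i + 1))) * real (card J))"
  proof (intro sum_mono mult_right_mono)
    fix i assume "i \<in> I"
    then have i: "real (i + 1) \<le> v"
      by (simp add: I_def)
    define s where "s = sqrt (real (i + 1) / v)"
    define W where "W = width v i"
    have s: "0 < s" "s \<le> 1"
      using i v_ge_1 by (auto simp: s_def)
    have "W = nat \<lfloor>max 1 (s * 2 ^ i)\<rfloor>"
      using s by (simp add: W_def width_def s_def min_def)
    moreover have "1 \<le> \<lfloor>max 1 (s * 2 ^ i)\<rfloor>"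
      by (simp add: le_floor_iff)
    \<comment> \<open>Rounding down a number that is at least 1 loses at most half of it.\<close>
    ultimately have W: "s * 2 ^ i \<le> 2 * real W"
      by linarith
    have "0 < W"
      by (simp add: W_def width_pos)
    have "real (card (Win i)) \<le> real ((t + 2 * 2 ^ i) div W) - real (t div W) + 1"
    proof -
      have "t div W \<le> (t + 2 * 2 ^ i) div W"
        by (intro div_le_mono) simp
      then show ?thesis
        by (simp add: Win_def W_def)
    qed
    also have "\<dots> \<le> (2 * 2 ^ i) / real W + 2"
    proof -
      \<comment> \<open>The two remainders add up to less than \<open>2 * W\<close>, so the carry is
        at most 1.\<close>
      have "(t + 2 * 2 ^ i) div W \<le> t div W + 2 * 2 ^ i div W + 1"
        by (simp add: div_add1_eq[of t "2 * 2 ^ i" W]) (metis (no_types) \<open>0 < W\<close> add_less_mono div_le_mono less_imp_le_nat mod_less_divisor mult_2 nonzero_mult_div_cancel_right less_mult_imp_div_less less_Suc_eq_le numeral_2_eq_2 One_nat_def)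
      then have "real ((t + 2 * 2 ^ i) div W) \<le> real (t div W) + real (2 * 2 ^ i div W) + 1"
        by (metis of_nat_1 of_nat_add of_nat_le_iff)
      moreover have "real (2 * 2 ^ i div W) \<le> real (2 * 2 ^ i) / real W"
        by (rule of_nat_div_le_of_nat)
      ultimately show ?thesis
        by simp
    qed
    also have "\<dots> \<le> 4 / s + 2"
      using W s \<open>0 < W\<close> by (simp add: field_simps)
    also have "\<dots> \<le> 6 / s"
      using s by (simp add: field_simps)
    also have "\<dots> = 6 * sqrt v * (1 / sqrt (real (i + 1)))"
      by (simp add: s_def real_sqrt_divide)
    finally show "real (card (Win i)) \<le> 6 * sqrt v * (1 / sqrt (real (i + 1)))" .
  qed simp
  also have "\<dots> \<le> (\<Sum>i<N + 1. 6 * sqrt v * (1 / sqrt (real (i + 1))) * real (card J))"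
    using v_ge_1 by (intro sum_mono2) (auto simp: I_def)
  also have "\<dots> = 6 * sqrt v * real (card J) * (\<Sum>i<N + 1. 1 / sqrt (real (i + 1)))"
    unfolding sum_distrib_left by (intro sum.cong refl) simp
  also have "\<dots> \<le> 6 * sqrt v * real (card J) * (2 * sqrt (real (N + 1)))"
    using v_ge_1 by (intro mult_left_mono sum_inverse_sqrt_le) auto
  also have "\<dots> = 12 * real (card J) * Q"
    unfolding Q_def real_sqrt_mult by simp
  finally show ?thesis .
qed

text \<open>The pool refused request \<open>j\<close>, so the total size of its type, pooled
  requests and all size classes included, exceeds the pool share, which is at least
  \<open>1 / (5 * S)\<close>.\<close>

lemma long_type_volume:
  assumes "j \<in> unpooled" and "v < real (cl j + 1)"
  shows "1 \<le> 5 * S * (\<Sum>k<n. if ty k = ty j then w k else 0)"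
proof -
  have j: "j < n" "\<not> pl j"
    using assms(1) by (auto simp: unpooled_def)
  define x where "x = sqrt (real (cl j + 1) / v)"
  have x: "0 < x" "x \<le> S"
    using v_ge_1 ratio_le_S[OF cl_le_N[OF j(1)]] by (auto simp: x_def)
  have "1 / x = sqrt (v / real (cl j + 1))"
    by (simp add: x_def real_sqrt_divide)
  then have share: "pool_share v (cl j) = 1 / x / 5"
    using assms(2) by (simp add: pool_share_def)
  have "pool_share v (cl j) < (\<Sum>k<j. if pl k \<and> ty k = ty j then w k else 0) + w j"
    using j(2) pooled.simps[of v rs j] by simp
  also have "\<dots> \<le> (\<Sum>k<Suc j. if ty k = ty j then w k else 0)"
    using w_pos j(1) by (auto intro!: add_mono sum_mono simp: less_imp_le)
  also have "\<dots> \<le> (\<Sum>k<n. if ty k = ty j then w k else 0)"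
    using w_pos j(1) by (intro sum_mono2) (auto simp: less_imp_le)
  finally have "1 \<le> 5 * x * (\<Sum>k<n. if ty k = ty j then w k else 0)"
    unfolding share using x(1) by (simp add: field_simps)
  also have "\<dots> \<le> 5 * S * (\<Sum>k<n. if ty k = ty j then w k else 0)"
    using x w_pos by (intro mult_right_mono sum_nonneg) (auto simp: less_imp_le)
  finally show ?thesis .
qed

text \<open>A key of a long class \<open>i\<close> is alive for at most \<open>3 * 2 ^ i\<close>
  steps: one window and the maximal length before it. By \<open>long_type_volume\<close> these steps
  are charged to the volume of its type with factor \<open>15 * S\<close>, once per size
  class.\<close>

lemma long_keys_bound:
  "(\<Sum>t=1..T. real (card {\<kappa> \<in> keys t. v < real (fst (fst \<kappa>) + 1)})) \<le>
    15 * real (card J) * Q * real T"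
proof -
  define K where "K = {\<kappa> \<in> ky ` unpooled. v < real (fst (fst \<kappa>) + 1)}"
  have [simp]: "finite K"
    by (simp add: K_def)
  let ?D = "\<lambda>\<kappa>. {t \<in> {1..T}. \<kappa> \<in> keys t}"
  have "(\<Sum>t=1..T. real (card {\<kappa> \<in> keys t. v < real (fst (fst \<kappa>) + 1)})) =
      (\<Sum>t=1..T. \<Sum>\<kappa>\<in>K. if \<kappa> \<in> keys t then 1 else 0)"
  proof (intro sum.cong refl)
    fix t
    have "{\<kappa> \<in> keys t. v < real (fst (fst \<kappa>) + 1)} = {\<kappa> \<in> K. \<kappa> \<in> keys t}"
      using keys_subset by (auto simp: K_def)
    then show "real (card {\<kappa> \<in> keys t. v < real (fst (fst \<kappa>) + 1)}) =
        (\<Sum>\<kappa>\<in>K. if \<kappa> \<in> keys t then 1 else 0)"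
      by (simp add: sum.If_cases Int_def)
  qed
  also have "\<dots> = (\<Sum>\<kappa>\<in>K. \<Sum>t=1..T. if \<kappa> \<in> keys t then 1 else 0)"
    by (rule sum.swap)
  also have "\<dots> = (\<Sum>\<kappa>\<in>K. real (card (?D \<kappa>)))"
    by (simp add: sum.If_cases Int_def)
  also have "\<dots> \<le> (\<Sum>\<kappa>\<in>K. 3 * 2 ^ fst (fst \<kappa>))"
  proof (rule sum_mono)
    fix \<kappa> assume \<kappa>: "\<kappa> \<in> K"
    define p :: nat where "p = 2 ^ fst (fst \<kappa>)"
    have "?D \<kappa> \<subseteq> {Suc (snd (fst \<kappa>) * p) - 2 * p..<snd (fst \<kappa>) * p + p}"
    proof
      fix t assume "t \<in> ?D \<kappa>"
      then obtain k where k: "k < n" "active (rs ! k) t" "ky k = \<kappa>"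
        by (auto simp: keys_def active_idx_def)
      have cl: "cl k = fst (fst \<kappa>)"
        using k(3) by (auto simp: key_of_def type_of_def)
      then have "finish (rs ! k) div p = snd (fst \<kappa>)"
        using \<kappa> k(3) width_long[of "cl k"] by (auto simp: K_def key_of_def type_of_def p_def)
      moreover have "0 < p"
        by (simp add: p_def)
      ultimately have "snd (fst \<kappa>) * p \<le> finish (rs ! k)" "finish (rs ! k) < snd (fst \<kappa>) * p + p"
        by (metis div_times_less_eq_dividend, metis dividend_less_times_div add.commute mult.commute)
      moreover have "start (rs ! k) \<le> t" "t < finish (rs ! k)" "finish (rs ! k) < start (rs ! k) + 2 * p"
        using k(2) duration_bounds(2)[OF k(1)] cl by (auto simp: active_def p_def)
      ultimately show "t \<in> {Suc (snd (fst \<kappa>) * p) - 2 * p..<snd (fst \<kappa>) * p + p}"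
        by auto
    qed
    then have "card (?D \<kappa>) \<le> card {Suc (snd (fst \<kappa>) * p) - 2 * p..<snd (fst \<kappa>) * p + p}"
      by (intro card_mono) auto
    also have "\<dots> \<le> 3 * p"
      by simp
    finally have "real (card (?D \<kappa>)) \<le> real (3 * p)"
      by (simp only: of_nat_le_iff)
    then show "real (card (?D \<kappa>)) \<le> 3 * 2 ^ fst (fst \<kappa>)"
      by (simp add: p_def)
  qed
  also have "\<dots> \<le> (\<Sum>\<kappa>\<in>fst ` K \<times> J. 3 * 2 ^ fst (fst \<kappa>))"
  proof (rule sum_mono2)
    show "K \<subseteq> fst ` K \<times> J"
    proof
      fix \<kappa> assume "\<kappa> \<in> K"
      moreover from this have "snd \<kappa> \<in> J"
        using cls_J by (auto simp: K_def unpooled_def key_of_def)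
      ultimately show "\<kappa> \<in> fst ` K \<times> J"
        by (simp add: mem_Times_iff)
    qed
  qed (use finite_J in auto)
  also have "\<dots> = (\<Sum>\<tau>\<in>fst ` K. \<Sum>c\<in>J. 3 * 2 ^ fst \<tau>)"
    by (simp add: sum.cartesian_product case_prod_beta del: sum_constant)
  also have "\<dots> = (\<Sum>\<tau>\<in>fst ` K. 3 * real (card J) * 2 ^ fst \<tau>)"
    by (simp add: mult_ac)
  also have "\<dots> \<le> (\<Sum>\<tau>\<in>fst ` K. 15 * real (card J) * S * (\<Sum>k<n. if ty k = \<tau> then w k * 2 ^ cl k else 0))"
  proof (rule sum_mono)
    fix \<tau> assume "\<tau> \<in> fst ` K"
    then obtain j where j: "j \<in> unpooled" "v < real (cl j + 1)" "\<tau> = ty j"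
      by (auto simp: K_def key_of_def type_of_def)
    have "3 * real (card J) * 2 ^ fst \<tau> * 1 \<le>
        3 * real (card J) * 2 ^ fst \<tau> * (5 * S * (\<Sum>k<n. if ty k = \<tau> then w k else 0))"
      using long_type_volume[OF j(1,2)] j(3) by (intro mult_left_mono) auto
    also have "\<dots> = 15 * real (card J) * S * (\<Sum>k<n. 2 ^ fst \<tau> * (if ty k = \<tau> then w k else 0))"
      by (simp add: sum_distrib_left[symmetric])
    also have "(\<Sum>k<n. 2 ^ fst \<tau> * (if ty k = \<tau> then w k else 0)) =
        (\<Sum>k<n. if ty k = \<tau> then w k * 2 ^ cl k else 0)"
      by (intro sum.cong refl) (auto simp: type_of_def)
    finally show "3 * real (card J) * 2 ^ fst \<tau> \<le>
        15 * real (card J) * S * (\<Sum>k<n. if ty k = \<tau> then w k * 2 ^ cl k else 0)"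
      by simp
  qed
  also have "\<dots> = 15 * real (card J) * S * (\<Sum>\<tau>\<in>fst ` K. \<Sum>k<n. if ty k = \<tau> then w k * 2 ^ cl k else 0)"
    by (simp add: sum_distrib_left)
  also have "(\<Sum>\<tau>\<in>fst ` K. \<Sum>k<n. if ty k = \<tau> then w k * 2 ^ cl k else 0) =
      (\<Sum>k<n. \<Sum>\<tau>\<in>fst ` K. if ty k = \<tau> then w k * 2 ^ cl k else 0)"
    by (rule sum.swap)
  also have "15 * real (card J) * S * \<dots> \<le> 15 * real (card J) * S * (\<Sum>k<n. w k * 2 ^ cl k)"
    using w_pos v_ge_1 by (intro mult_left_mono sum_mono) (auto simp: sum.delta' S_def less_imp_le)
  also have "\<dots> \<le> 15 * real (card J) * S * (v * real T)"
    using volume_le v_ge_1 by (intro mult_left_mono) (auto simp: S_def)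
  finally show ?thesis
    by (simp add: S_times_v[symmetric] mult.assoc)
qed

text \<open>\<open>X t\<close> is what the keys whose window has not begun cost beyond one bin each.
  It is left open because it comes from Harmonic for general sizes and from the total size for
  uniform ones.\<close>

lemma avg_cost_bound:
  assumes X: "\<And>t. t \<in> {1..T} \<Longrightarrow>
    (\<Sum>\<kappa>\<in>{\<kappa> \<in> keys t. \<not> departing t \<kappa>}. real (next_fit (active_weights t \<kappa>))) \<le>
      X t + real (card {\<kappa> \<in> keys t. \<not> departing t \<kappa>})"
    and "1 \<le> card J"
  shows "avg_cost T rs (schedule_with_avg_load (avg_load_alg cls) T rs) \<le>
    (\<Sum>t=1..T. X t) / real T + 35 * real (card J) * Q"
proof -
  let ?\<sigma> = "schedule_with_avg_load (avg_load_alg cls) T rs"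
  let ?A = "\<lambda>t. real (card {\<kappa> \<in> keys t. real (fst (fst \<kappa>) + 1) \<le> v})"
  let ?B = "\<lambda>t. real (card {\<kappa> \<in> keys t. v < real (fst (fst \<kappa>) + 1)})"
  let ?V = "\<lambda>t. \<Sum>\<kappa>\<in>{\<kappa> \<in> keys t. departing t \<kappa>}. key_volume \<kappa>"
  have split: "card {\<kappa> \<in> keys t. P \<kappa>} + card {\<kappa> \<in> keys t. \<not> P \<kappa>} = card (keys t)" for P and t
    by (subst card_Un_disjoint[symmetric]) (auto intro!: arg_cong[of _ _ card])
  have "real (cost T rs ?\<sigma>) = (\<Sum>t=1..T. real (card (class_machine v cls rs ` active_idx rs t)))"
    unfolding cost_def of_nat_sum
    by (intro sum.cong refl arg_cong[of _ _ real] card_to_nat_machines avg_load_schedule)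
  also have "\<dots> \<le> (\<Sum>t=1..T. X t + 6 * Q + 12 * real (card J) * Q + ?B t + 2 * ?V t)"
  proof (rule sum_mono)
    fix t assume t: "t \<in> {1..T}"
    have "real (card {\<kappa> \<in> keys t. \<not> departing t \<kappa>}) + real (card {\<kappa> \<in> keys t. departing t \<kappa>}) =
        ?A t + ?B t"
      using split[of t "departing t"] split[of t "\<lambda>\<kappa>. real (fst (fst \<kappa>) + 1) \<le> v"]
      by (simp add: not_le flip: of_nat_add)
    moreover have "(\<Sum>\<kappa>\<in>{\<kappa> \<in> keys t. departing t \<kappa>}. 1 + 2 * key_volume \<kappa>) =
        real (card {\<kappa> \<in> keys t. departing t \<kappa>}) + 2 * ?V t"
      by (simp add: sum.distrib sum_distrib_left)
    ultimately show "real (card (class_machine v cls rs ` active_idx rs t)) \<le>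
        X t + 6 * Q + 12 * real (card J) * Q + ?B t + 2 * ?V t"
      using machines_le[of t] pool_machines_bound[of t] short_keys_bound[of t] X[OF t] by linarith
  qed
  also have "\<dots> = (\<Sum>t=1..T. X t) + (6 * Q + 12 * real (card J) * Q) * real T +
      (\<Sum>t=1..T. ?B t) + 2 * (\<Sum>t=1..T. ?V t)"
    by (simp add: sum.distrib sum_distrib_left algebra_simps)
  also have "\<dots> \<le> (\<Sum>t=1..T. X t) + (6 * Q + 12 * real (card J) * Q) * real T +
      15 * real (card J) * Q * real T + 2 * (Q * real T)"
    using long_keys_bound departing_volume by linarith
  \<comment> \<open>Pool machines contribute 6 and departing bins 2, short keys
    \<open>12 * card J\<close> and long keys \<open>15 * card J\<close>; as
    \<open>1 \<le> card J\<close>, this is at most \<open>35 * card J\<close>.\<close>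
  also have "\<dots> = (\<Sum>t=1..T. X t) + (8 * (1 * Q) + 27 * real (card J) * Q) * real T"
    by (simp add: algebra_simps)
  also have "\<dots> \<le> (\<Sum>t=1..T. X t) + (8 * (real (card J) * Q) + 27 * real (card J) * Q) * real T"
    using assms(2) Q_ge_1
    by (intro add_left_mono mult_right_mono add_right_mono mult_left_mono) auto
  finally have "real (cost T rs ?\<sigma>) \<le> (\<Sum>t=1..T. X t) + 35 * real (card J) * Q * real T"
    by (simp add: algebra_simps)
  then show ?thesis
    using T_pos by (simp add: avg_cost_def field_simps)
qed

section \<open>The bounds for general and for uniform sizes\<close>

lemma sum_active_weights_le:
  assumes "A \<subseteq> keys t"
  shows "(\<Sum>\<kappa>\<in>A. sum_list (active_weights t \<kappa>)) \<le> total_weight rs t"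
proof -
  let ?X = "{j \<in> active_idx rs t. \<not> pl j}"
  have aw: "sum_list (active_weights t \<kappa>) = sum w {j \<in> ?X. ky j = \<kappa>}" for \<kappa>
    unfolding active_weights_def
    by (subst sum_list_distinct_conv_sum_set) (auto simp: active_idx_def intro!: sum.cong)
  have "(\<Sum>\<kappa>\<in>A. sum_list (active_weights t \<kappa>)) \<le> (\<Sum>\<kappa>\<in>keys t. sum w {j \<in> ?X. ky j = \<kappa>})"
    unfolding aw using assms w_pos
    by (intro sum_mono2 sum_nonneg) (auto simp: active_idx_def less_imp_le)
  also have "\<dots> = sum w ?X"
    unfolding keys_def by (rule sum.image_gen[symmetric]) simp
  also have "\<dots> \<le> total_weight rs t"
    unfolding total_weight_def using w_pos
    by (intro sum_mono2) (auto simp: active_idx_def less_imp_le)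
  finally show ?thesis .
qed

lemma max_duration_pos: "1 \<le> max_duration rs"
proof -
  have "\<exists>i. i < n"
    using load_pos[of 1] T_pos by (cases rs) (auto simp: load_def active_idx_def)
  then obtain i where i: "i < n" ..
  have "1 \<le> duration (rs ! i)"
    using instance_request(2)[OF inst i] by (simp add: duration_def)
  also have "\<dots> \<le> max_duration rs"
    using i by (rule duration_le_max_duration)
  finally show ?thesis .
qed

lemma Q_le:
  assumes "real (N + 1) \<le> 2 * L"
  shows "Q \<le> 2 * sqrt (OPT_avg T rs * L)"
proof -
  have "v * real (N + 1) \<le> OPT_avg T rs * (2 * L)"
    using avg_load_le_OPT_avg[OF inst] assms v_ge_1 by (intro mult_mono) auto
  also have "\<dots> \<le> 4 * (OPT_avg T rs * L)"
  proof -
    have "0 \<le> OPT_avg T rs * L"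
      using avg_load_le_OPT_avg[OF inst] assms v_ge_1 by (intro mult_nonneg_nonneg) auto
    then show ?thesis by linarith
  qed
  finally have "Q \<le> sqrt (4 * (OPT_avg T rs * L))"
    unfolding Q_def by (rule real_sqrt_le_mono)
  then show ?thesis
    by (simp add: real_sqrt_mult)
qed

lemma N_le_log: "real N \<le> log 2 (real (max_duration rs))"
  using max_duration_pos unfolding N_def floor_log_altdef by simp

text \<open>Within each size class the groups of different types are concatenated, at one extra bin
  per nonempty key. The results are the size classes of a single input \<open>xs\<close>, so the
  ratio of Harmonic applies, and \<open>\<sigma>\<close> packs \<open>xs\<close> at time
  \<open>t\<close>.\<close>

lemma nondeparting_harmonic:
  fixes t :: nat and k :: nat
  defines "ND \<equiv> {\<kappa> \<in> keys t. \<not> departing t \<kappa>}"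
  assumes cls: "cls = size_class k" and J: "J = {1..k}" and k: "1 \<le> k" and \<sigma>: "feasible rs \<sigma>"
  shows "(\<Sum>\<kappa>\<in>ND. real (next_fit (active_weights t \<kappa>))) \<le>
    harmonic_ratio k * real (card (\<sigma> ` active_idx rs t)) + real k + real (card ND)"
proof -
  have [simp]: "finite ND"
    by (simp add: ND_def)
  obtain ts where ts: "distinct ts" "set ts = fst ` ND"
    using finite_distinct_list[of "fst ` ND"] by auto
  define js where "js = concat (map (\<lambda>\<tau>. filter (\<lambda>j. \<not> pl j \<and> ty j = \<tau> \<and> active (rs ! j) t) [0..<n]) ts)"
  define xs where "xs = map w js"
  have js_active: "set js \<subseteq> active_idx rs t"
    by (auto simp: js_def active_idx_def)
  have "distinct js"
    unfolding js_def using ts(1)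
    by (induction ts) auto
  have xs: "set xs \<subseteq> {0<..1}"
    using js_active w_pos w_le_1 by (auto simp: xs_def active_idx_def)
  have filter_xs: "filter (\<lambda>x. size_class k x = c) xs = concat (map (\<lambda>\<tau>. active_weights t (\<tau>, c)) ts)" for c
    unfolding xs_def js_def active_weights_def
    by (simp add: filter_concat map_concat filter_map o_def key_of_def cls conj_ac)
  have "(\<Sum>\<kappa>\<in>ND. next_fit (active_weights t \<kappa>)) \<le> (\<Sum>\<kappa>\<in>fst ` ND \<times> J. next_fit (active_weights t \<kappa>))"
  proof (rule sum_mono2)
    show "ND \<subseteq> fst ` ND \<times> J"
    proof
      fix \<kappa> assume "\<kappa> \<in> ND"
      moreover from this have "snd \<kappa> \<in> J"
        using cls_J by (auto simp: ND_def keys_def active_idx_def key_of_def)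
      ultimately show "\<kappa> \<in> fst ` ND \<times> J"
        by (simp add: mem_Times_iff)
    qed
  qed (use finite_J in auto)
  also have "\<dots> = (\<Sum>c\<in>J. \<Sum>\<tau>\<in>fst ` ND. next_fit (active_weights t (\<tau>, c)))"
    by (subst sum.swap) (simp add: sum.cartesian_product case_prod_beta)
  also have "\<dots> = (\<Sum>c\<in>J. \<Sum>\<tau>\<leftarrow>ts. next_fit (active_weights t (\<tau>, c)))"
    by (simp add: sum_list_distinct_conv_sum_set ts)
  also have "\<dots> \<le> (\<Sum>c\<in>J. next_fit (filter (\<lambda>x. size_class k x = c) xs) +
      length (filter (\<lambda>\<tau>. active_weights t (\<tau>, c) \<noteq> []) ts))"
    unfolding filter_xs using set_active_weights by (intro sum_mono next_fit_concat_ge)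
  also have "\<dots> = harmonic k xs + (\<Sum>c\<in>J. length (filter (\<lambda>\<tau>. active_weights t (\<tau>, c) \<noteq> []) ts))"
    by (simp add: sum.distrib harmonic_eq[OF k xs] J)
  also have "(\<Sum>c\<in>J. length (filter (\<lambda>\<tau>. active_weights t (\<tau>, c) \<noteq> []) ts)) \<le> card ND"
  proof -
    have "(\<Sum>c\<in>J. length (filter (\<lambda>\<tau>. active_weights t (\<tau>, c) \<noteq> []) ts)) =
        (\<Sum>c\<in>J. card {\<tau> \<in> fst ` ND. active_weights t (\<tau>, c) \<noteq> []})"
      using ts by (intro sum.cong refl) (metis (no_types) distinct_card distinct_filter set_filter)
    also have "\<dots> = card (SIGMA c:J. {\<tau> \<in> fst ` ND. active_weights t (\<tau>, c) \<noteq> []})"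
      using finite_J by (intro card_SigmaI[symmetric]) auto
    also have "\<dots> = card (prod.swap ` (SIGMA c:J. {\<tau> \<in> fst ` ND. active_weights t (\<tau>, c) \<noteq> []}))"
      by (rule card_image[symmetric]) simp
    also have "\<dots> \<le> card ND"
    proof (rule card_mono)
      show "prod.swap ` (SIGMA c:J. {\<tau> \<in> fst ` ND. active_weights t (\<tau>, c) \<noteq> []}) \<subseteq> ND"
      proof
        fix \<kappa> assume "\<kappa> \<in> prod.swap ` (SIGMA c:J. {\<tau> \<in> fst ` ND. active_weights t (\<tau>, c) \<noteq> []})"
        then have aw: "active_weights t \<kappa> \<noteq> []" and fst: "fst \<kappa> \<in> fst ` ND"
          by (elim imageE SigmaE, simp)+
        from aw have "\<kappa> \<in> keys t"
          by (auto simp: active_weights_def filter_empty_conv keys_def active_idx_def)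
        \<comment> \<open>Whether the window has begun depends on the type alone, so this passes to
          every size class of the type.\<close>
        moreover have "\<not> departing t \<kappa>"
          using fst by (auto simp: ND_def departing_def)
        ultimately show "\<kappa> \<in> ND"
          by (simp add: ND_def)
      qed
    qed simp
    finally show ?thesis .
  qed
  finally have "(\<Sum>\<kappa>\<in>ND. next_fit (active_weights t \<kappa>)) \<le> harmonic k xs + card ND"
    by simp
  then have "(\<Sum>\<kappa>\<in>ND. real (next_fit (active_weights t \<kappa>))) \<le> real (harmonic k xs) + real (card ND)"
    by (simp flip: of_nat_sum of_nat_add)
  also have "real (harmonic k xs) \<le> harmonic_ratio k * real (opt_bins xs) + real k"
    by (rule harmonic_le_ratio[OF k xs])
  also have "harmonic_ratio k * real (opt_bins xs) \<le>
      harmonic_ratio k * real (card (\<sigma> ` active_idx rs t))"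
  proof (rule mult_left_mono)
    show "real (opt_bins xs) \<le> real (card (\<sigma> ` active_idx rs t))"
      unfolding xs_def of_nat_le_iff
      using packable_active[OF \<sigma> \<open>distinct js\<close> js_active w_pos] by (rule opt_bins_le)
    show "0 \<le> harmonic_ratio k"
      using k by (rule harmonic_ratio_nonneg)
  qed
  finally show ?thesis
    by simp
qed

lemma avg_cost_nonuniform:
  assumes "cls = size_class k" and J: "J = {1..k}" and k: "1 \<le> k"
  shows "avg_cost T rs (schedule_with_avg_load (avg_load_alg cls) T rs) \<le>
    harmonic_ratio k * OPT_avg T rs +
      real k * (72 * sqrt (OPT_avg T rs * max 1 (log 2 (real (max_duration rs)))))"
proof -
  obtain \<sigma> where \<sigma>: "feasible rs \<sigma>" "cost T rs \<sigma> = OPT T rs"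
    using OPT_attained[OF inst] by blast
  have "avg_cost T rs (schedule_with_avg_load (avg_load_alg cls) T rs) \<le>
    (\<Sum>t=1..T. harmonic_ratio k * real (card (\<sigma> ` active_idx rs t)) + real k) / real T +
      35 * real (card J) * Q"
    using nondeparting_harmonic[OF assms \<sigma>(1)] k by (intro avg_cost_bound) (auto simp: J)
  also have "(\<Sum>t=1..T. harmonic_ratio k * real (card (\<sigma> ` active_idx rs t)) + real k) / real T =
      harmonic_ratio k * OPT_avg T rs + real k"
    using T_pos unfolding OPT_avg_def \<sigma>(2)[symmetric] cost_def
    by (simp add: sum.distrib sum_distrib_left field_simps)
  \<comment> \<open>The additive \<open>k\<close> of Harmonic is absorbed by
    \<open>1 \<le> Q\<close>, which turns 35 into 36; \<open>Q_le\<close> then doubles this to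
    72.\<close>
  also have "\<dots> + 35 * real (card J) * Q \<le> harmonic_ratio k * OPT_avg T rs + real k * (36 * Q)"
    using Q_ge_1 mult_left_mono[of 1 Q "real k"] by (simp add: J algebra_simps)
  also have "36 * Q \<le> 72 * sqrt (OPT_avg T rs * max 1 (log 2 (real (max_duration rs))))"
    using Q_le[of "max 1 (log 2 (real (max_duration rs)))"] N_le_log by simp
  finally show ?thesis
    by (simp add: mult_left_mono)
qed

lemma next_fit_active_uniform:
  assumes "uniform_size rs"
  shows "real (next_fit (active_weights t \<kappa>)) < 1 + sum_list (active_weights t \<kappa>)"
proof -
  obtain g :: nat where g: "1 \<le> g" "\<And>r. r \<in> set rs \<Longrightarrow> weight r = 1 / real g"
    using assms unfolding uniform_size_def by blast
  then have "set (active_weights t \<kappa>) \<subseteq> {1 / real g}"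
    by (auto simp: active_weights_def)
  then show ?thesis
    by (rule next_fit_uniform[OF g(1)])
qed

text \<open>Here the logarithm vanishes and no error is allowed. All requests active at a time share
  one key, none is pooled or departing, and Next-Fit on equal sizes opens no more bins than the
  rounded-up load.\<close>

lemma avg_cost_uniform_unit_durations:
  assumes unif: "uniform_size rs" and "max_duration rs = 1" and cls: "cls = (\<lambda>_. 0)"
  shows "avg_cost T rs (schedule_with_avg_load (avg_load_alg cls) T rs) \<le> OPT_avg T rs"
proof -
  let ?M = "class_machine v cls rs"
  have unit: "start (rs ! j) = t" "finish (rs ! j) = t + 1" "cl j = 0" if "j \<in> active_idx rs t" for j t
  proof -
    have j: "j < n" "active (rs ! j) t"
      using that by (auto simp: active_idx_def)
    have "duration (rs ! j) \<le> 1"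
      using duration_le_max_duration[OF j(1)] assms(2) by simp
    then show "start (rs ! j) = t" "finish (rs ! j) = t + 1"
      using j(2) by (auto simp: duration_def active_def)
    then show "cl j = 0"
      by (simp add: length_class_def duration_def)
  qed
  have unpl: "\<not> pl j" if "j \<in> active_idx rs t" for j t
    using pooled_long[of j] unit(3)[OF that] v_ge_1 that by (auto simp: active_idx_def)
  have [simp]: "width v 0 = 1"
    by (simp add: width_def max_def min_def)
  have keys: "keys t \<subseteq> {((0, t + 1), 0)}" for t
    unfolding keys_def using unit by (auto simp: key_of_def type_of_def cls)
  have "card (?M ` active_idx rs t) \<le> load rs t" for t
  proof -
    have "\<not> departing t \<kappa>" if "\<kappa> \<in> keys t" for \<kappa>
    proof -
      have "\<kappa> = ((0, t + 1), 0)"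
        using that keys by blast
      then show ?thesis
        by (simp add: departing_def)
    qed
    then have nd: "{\<kappa> \<in> keys t. departing t \<kappa>} = {}" "{\<kappa> \<in> keys t. \<not> departing t \<kappa>} = keys t"
      by blast+
    have "pool_machines t = {}"
      using unpl by (auto simp: pool_machines_def)
    then have "real (card (?M ` active_idx rs t)) \<le>
        (\<Sum>\<kappa>\<in>keys t. real (next_fit (active_weights t \<kappa>)))"
      using machines_le[of t] unfolding nd by simp
    also have "\<dots> \<le> real (load rs t)"
    proof (cases "keys t = {}")
      case False
      then have kt: "keys t = {((0, t + 1), 0)}"
        using keys by blast
      have "real (next_fit (active_weights t ((0, t + 1), 0))) < 1 + total_weight rs t"
        using next_fit_active_uniform[OF unif, of t "((0, t + 1), 0)"]
          sum_active_weights_le[of "keys t" t] by (simp add: kt)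
      also have "\<dots> \<le> real (load rs t) + 1"
        using total_weight_le_load by simp
      finally show ?thesis
        by (simp add: kt)
    qed simp
    finally show ?thesis
      by simp
  qed
  moreover have "card (schedule_with_avg_load (avg_load_alg cls) T rs ` active_idx rs t) =
      card (?M ` active_idx rs t)" for t
    by (intro card_to_nat_machines avg_load_schedule)
  ultimately show ?thesis
    using avg_cost_le_if_le_load[OF inst, of "schedule_with_avg_load (avg_load_alg cls) T rs" 1]
    by simp
qed

lemma avg_cost_uniform:
  assumes unif: "uniform_size rs" and cls: "cls = (\<lambda>_. 0)" and J: "J = {0}"
  shows "avg_cost T rs (schedule_with_avg_load (avg_load_alg cls) T rs) \<le>
    OPT_avg T rs + 70 * sqrt (OPT_avg T rs * log 2 (real (max_duration rs)))"
proof (cases "max_duration rs = 1")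
  case True
  then show ?thesis
    using avg_cost_uniform_unit_durations[OF unif True cls] by simp
next
  case False
  \<comment> \<open>From length 2 on the logarithm is at least 1 and can absorb the 1 in
    \<open>N + 1\<close>.\<close>
  then have "1 \<le> log 2 (real (max_duration rs))"
    using max_duration_pos by (simp add: le_log_iff)
  then have Q: "Q \<le> 2 * sqrt (OPT_avg T rs * log 2 (real (max_duration rs)))"
    using N_le_log by (intro Q_le) simp
  have "avg_cost T rs (schedule_with_avg_load (avg_load_alg cls) T rs) \<le>
    (\<Sum>t=1..T. total_weight rs t) / real T + 35 * real (card J) * Q"
  proof (rule avg_cost_bound)
    fix t
    let ?ND = "{\<kappa> \<in> keys t. \<not> departing t \<kappa>}"
    have "(\<Sum>\<kappa>\<in>?ND. real (next_fit (active_weights t \<kappa>))) \<le>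
        (\<Sum>\<kappa>\<in>?ND. 1 + sum_list (active_weights t \<kappa>))"
      using next_fit_active_uniform[OF unif] by (intro sum_mono less_imp_le)
    also have "\<dots> = real (card ?ND) + (\<Sum>\<kappa>\<in>?ND. sum_list (active_weights t \<kappa>))"
      by (simp add: sum.distrib)
    also have "\<dots> \<le> real (card ?ND) + total_weight rs t"
      by (intro add_left_mono sum_active_weights_le) auto
    finally show "(\<Sum>\<kappa>\<in>?ND. real (next_fit (active_weights t \<kappa>))) \<le>
        total_weight rs t + real (card ?ND)"
      by simp
  qed (simp add: J)
  also have "(\<Sum>t=1..T. total_weight rs t) / real T \<le> v"
    unfolding avg_load_def by (intro divide_right_mono sum_mono total_weight_le_load) simp
  also have "v \<le> OPT_avg T rs"
    by (rule avg_load_le_OPT_avg[OF inst])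
  finally show ?thesis
    using Q by (simp add: J)
qed

end

theorem theorem1p2:
  shows
    "(\<exists>C::real. \<forall>k\<ge>2. \<exists>A. \<forall>T rs. dbp_instance T rs \<longrightarrow>
        feasible rs (schedule_with_avg_load A T rs) \<and>
        avg_cost T rs (schedule_with_avg_load A T rs)
          \<le> harmonic_ratio k * OPT_avg T rs
             + real k * (C * sqrt (OPT_avg T rs * max 1 (log 2 (real (max_duration rs))))))
   \<and> (\<exists>C::real. \<exists>A. \<forall>T rs. dbp_instance T rs \<and> uniform_size rs \<longrightarrow>
        feasible rs (schedule_with_avg_load A T rs) \<and>
        avg_cost T rs (schedule_with_avg_load A T rs)
          \<le> OPT_avg T rs + C * sqrt (OPT_avg T rs * log 2 (real (max_duration rs))))
   \<and> (\<exists>A. \<forall>T rs. dbp_instance T rs \<longrightarrow>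
        feasible rs (schedule_with_future_loads A rs) \<and>
        avg_cost T rs (schedule_with_future_loads A rs) \<le> 8 * OPT_avg T rs)
   \<and> (\<exists>A. \<forall>T rs. dbp_instance T rs \<and> uniform_size rs \<longrightarrow>
        feasible rs (schedule_with_future_loads A rs) \<and>
        avg_cost T rs (schedule_with_future_loads A rs) \<le> 2 * OPT_avg T rs)"
proof (intro conjI)
  show "\<exists>C::real. \<forall>k\<ge>2. \<exists>A. \<forall>T rs. dbp_instance T rs \<longrightarrow>
        feasible rs (schedule_with_avg_load A T rs) \<and>
        avg_cost T rs (schedule_with_avg_load A T rs)
          \<le> harmonic_ratio k * OPT_avg T rs
             + real k * (C * sqrt (OPT_avg T rs * max 1 (log 2 (real (max_duration rs)))))"
  \<comment> \<open>One constant serves every \<open>k\<close>; only the algorithm depends on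
    \<open>k\<close>.\<close>
  proof (rule exI[of _ 72], intro allI impI)
    fix k :: nat assume k: "2 \<le> k"
    have run: "avg_load_run T rs (size_class k) {1..k}" if "dbp_instance T rs" for T rs
      using that instance_request[OF that] size_class_range[of _ k] k by unfold_locales auto
    show "\<exists>A. \<forall>T rs. dbp_instance T rs \<longrightarrow> feasible rs (schedule_with_avg_load A T rs) \<and>
        avg_cost T rs (schedule_with_avg_load A T rs) \<le> harmonic_ratio k * OPT_avg T rs
             + real k * (72 * sqrt (OPT_avg T rs * max 1 (log 2 (real (max_duration rs)))))"
      using avg_load_run.class_machine_feasible[OF run] avg_load_run.avg_cost_nonuniform[OF run] k
      by (intro exI[of _ "avg_load_alg (size_class k)"]) auto
  qed
  have run: "avg_load_run T rs (\<lambda>_. 0) {0}" if "dbp_instance T rs" for T rs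
    using that by unfold_locales auto
  show "\<exists>C::real. \<exists>A. \<forall>T rs. dbp_instance T rs \<and> uniform_size rs \<longrightarrow>
        feasible rs (schedule_with_avg_load A T rs) \<and>
        avg_cost T rs (schedule_with_avg_load A T rs)
          \<le> OPT_avg T rs + C * sqrt (OPT_avg T rs * log 2 (real (max_duration rs)))"
    using avg_load_run.class_machine_feasible[OF run] avg_load_run.avg_cost_uniform[OF run]
    by (intro exI[of _ 70] exI[of _ "avg_load_alg (\<lambda>_. 0)"]) blast
  show "\<exists>A. \<forall>T rs. dbp_instance T rs \<longrightarrow>
        feasible rs (schedule_with_future_loads A rs) \<and>
        avg_cost T rs (schedule_with_future_loads A rs) \<le> 8 * OPT_avg T rs"
    using future_loads_nonuniform by blast
  show "\<exists>A. \<forall>T rs. dbp_instance T rs \<and> uniform_size rs \<longrightarrow>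
        feasible rs (schedule_with_future_loads A rs) \<and>
        avg_cost T rs (schedule_with_future_loads A rs) \<le> 2 * OPT_avg T rs"
    using future_loads_uniform by blast
qed

end
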